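(* There are constants $c_0,c>0$ (depending only on the model parameters $q,p_\circ,p_\bullet$, not on $\rho$) such that the following holds. Let $B=([a,b]\times[n,n'])\cap\mathbb Z^2$ be a space-time box with $n\ge c_0$, and let $D=\mathbb Z\times\mathbb Z_-$ (with $\mathbb Z_-=\{0,-1,-2,\dots\}$). Let $f_1,f_2:\Omega\to[0,1]$ be non-increasing random variables with support in $D$ and in $B$, respectively. Then for every $\rho\ge1$, $$\mathbb E^{\rho(1+n^{-1/16})}[f_1f_2]\le \mathbb E^{\rho(1+n^{-1/16})}[f_1]\,\mathbb E^{\rho}[f_2]+c\,(\mathrm{per}(B)+n)\,e^{-c\rho n^{1/8}},$$ where $\mathrm{per}(B)$ is the perimeter of $B$.
   Context: Fix $q\in(0,1)$ and $p_\circ,p_\bullet\in[0,1]$. A lazy simple random walk on $\mathbb Z$ has i.i.d. steps $-1,0,1$ with probabilities $\frac{1-q}{2},q,\frac{1-q}{2}$. Let $W$ be the set of two-sided paths $w=(w(n))_{n\in\mathbb Z}$ in $\mathbb Z$ with $|w(n+1)-w(n)|\le1$, $P_x$ the law on $W$ of a two-sided lazy simple random walk with $w(0)=x$, and $\mu=\sum_xP_x$. Under $\mathbb P^\rho$ one has a Poisson point process $\omega$ on $W$ of intensity $\rho\mu$ and, independently, i.i.d. uniform $[0,1]$ variables $\xi=(U_y)_{y\in\mathbb Z^2}$; $\Omega$ is the space of pairs $(\omega,\xi)$. Space-time points are $(x,n)\in\mathbb Z^2$ ($n$ is time). $\mathcal T(\omega)\subset\mathbb Z^2$ is the set of space-time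 points $(w(n),n)$ visited by some trajectory $w$ of $\omega$. Write $\omega\le\omega'$ if $\mathcal T(\omega)\subset\mathcal T(\omega')$. A random variable $f:\Omega\to\mathbb R$ is non-increasing if $f(\omega',\xi)\le f(\omega,\xi)$ for all $\omega\le\omega'$ and all $\xi$. It has support in $B\subset\mathbb Z^2$ if $f(\omega,\xi)=f(\omega',\xi')$ whenever $\mathcal T(\omega)\cap B=\mathcal T(\omega')\cap B$ and $\xi(y)=\xi'(y)$ for all $y\in B$. *)

theory Defs
  imports "HOL-Probability.Probability"
begin

definition Wpaths :: "(int \<Rightarrow> int) set" where
  "Wpaths = {w. \<forall>n. \<bar>w (n + 1) - w n\<bar> \<le> 1}"

text \<open>Configurations: a configuration omega is (the set of) its trajectories; xi the uniforms.
  Omega is the space of pairs (omega, xi).\<close>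
type_synonym config = "(int \<Rightarrow> int) set"
type_synonym unifs = "int \<times> int \<Rightarrow> real"

definition Omega :: "(config \<times> unifs) set" where
  "Omega = {(\<omega>, \<xi>). \<omega> \<subseteq> Wpaths \<and> (\<forall>y. \<xi> y \<in> {0..1})}"

definition traj :: "config \<Rightarrow> (int \<times> int) set" where
  "traj \<omega> = {(w n, n) | w n. w \<in> \<omega>}"

definition nonincreasing :: "(config \<times> unifs \<Rightarrow> real) \<Rightarrow> bool" where
  "nonincreasing f \<longleftrightarrow>
     (\<forall>\<omega> \<omega>' \<xi>. (\<omega>, \<xi>) \<in> Omega \<longrightarrow> (\<omega>', \<xi>) \<in> Omega \<longrightarrow> traj \<omega> \<subseteq> traj \<omega>'
        \<longrightarrow> f (\<omega>', \<xi>) \<le> f (\<omega>, \<xi>))"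

definition has_support :: "(config \<times> unifs \<Rightarrow> real) \<Rightarrow> (int \<times> int) set \<Rightarrow> bool" where
  "has_support f B \<longleftrightarrow>
     (\<forall>\<omega> \<xi> \<omega>' \<xi>'. (\<omega>, \<xi>) \<in> Omega \<longrightarrow> (\<omega>', \<xi>') \<in> Omega \<longrightarrow>
        traj \<omega> \<inter> B = traj \<omega>' \<inter> B \<longrightarrow> (\<forall>y\<in>B. \<xi> y = \<xi>' y) \<longrightarrow> f (\<omega>, \<xi>) = f (\<omega>', \<xi>'))"

definition step_pmf :: "real \<Rightarrow> int pmf" where
  "step_pmf q = do { b \<leftarrow> bernoulli_pmf q; if b then return_pmf 0 else pmf_of_set {-1, 1} }"

text \<open>Construction of the Poisson point process of intensity rho * sum_x P_x:
  independently for each x, N x ~ Poisson(rho) trajectories started at x, the k-th of which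
  is the two-sided lazy walk with iid steps S (x, k, m) (step from time m to m+1);
  independently, iid uniform [0,1] variables U indexed by Z^2.\<close>
definition base_space :: "real \<Rightarrow> real \<Rightarrow>
    ((int \<Rightarrow> nat) \<times> (int \<times> nat \<times> int \<Rightarrow> int) \<times> unifs) measure" where
  "base_space q \<rho> =
     (PiM UNIV (\<lambda>_::int. measure_pmf (poisson_pmf \<rho>))) \<Otimes>\<^sub>M
     ((PiM UNIV (\<lambda>_::int \<times> nat \<times> int. measure_pmf (step_pmf q))) \<Otimes>\<^sub>M
      (PiM UNIV (\<lambda>_::int \<times> int. uniform_measure lborel {0..1::real})))"

definition walk :: "(int \<times> nat \<times> int \<Rightarrow> int) \<Rightarrow> int \<Rightarrow> nat \<Rightarrow> int \<Rightarrow> int" where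
  "walk S x k n = x + (if 0 \<le> n then (\<Sum>i\<in>{0..<n}. S (x, k, i)) else - (\<Sum>i\<in>{n..<0}. S (x, k, i)))"

definition conf_of :: "(int \<Rightarrow> nat) \<times> (int \<times> nat \<times> int \<Rightarrow> int) \<times> unifs \<Rightarrow> config" where
  "conf_of r = {walk (fst (snd r)) x k | x k. k < fst r x}"

definition outcome :: "(int \<Rightarrow> nat) \<times> (int \<times> nat \<times> int \<Rightarrow> int) \<times> unifs \<Rightarrow> config \<times> unifs" where
  "outcome r = (conf_of r, snd (snd r))"

definition Exp :: "real \<Rightarrow> real \<Rightarrow> (config \<times> unifs \<Rightarrow> real) \<Rightarrow> real" where
  "Exp q \<rho> f = (\<integral>r. f (outcome r) \<partial>base_space q \<rho>)"

definition random_var :: "real \<Rightarrow> (config \<times> unifs \<Rightarrow> real) \<Rightarrow> bool" where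
  "random_var q f \<longleftrightarrow> (\<forall>\<rho>>0. (\<lambda>r. f (outcome r)) \<in> borel_measurable (base_space q \<rho>))"

definition box :: "int \<Rightarrow> int \<Rightarrow> int \<Rightarrow> int \<Rightarrow> (int \<times> int) set" where
  "box a b n n' = {a..b} \<times> {n..n'}"

definition perimeter :: "int \<Rightarrow> int \<Rightarrow> int \<Rightarrow> int \<Rightarrow> real" where
  "perimeter a b n n' = 2 * (real_of_int (b - a) + real_of_int (n' - n))"

definition Dneg :: "(int \<times> int) set" where
  "Dneg = UNIV \<times> {..0}"

end

(*
Index a trajectory by its position x at time 0. Given the numbers N x of trajectories at the sites x,
the part of the configuration at times <= 0 and the part at times > 0 are independent, so it suffices
to compare, for most N, the law of the trace in B given N with its law at density rho.

Cut the sites from which B can be reached (the walks have speed at most 1) into cells of length about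
n^(1/4). With eps = n^(-1/16), Chernoff bounds of order exp(- c rho n^(1/4) eps^2) = exp(- c rho n^(1/8))
show that at density rho (1 + eps) every cell contains more particles than a Poisson variable of
density rho (1 + eps/4). Up to this error, the given particles of a cell thus dominate a Poisson number of
particles, each kept with the part of its time-n law that is common to the whole cell. By thinning
these form a Poisson cloud at time n, whose density at y is rho (1 + eps/4) times
the sum over cells I of |I| min_{z in I} p_n(y - z), which is at least 1 - n^(1/4) sum_u |p_n(u+1) - p_n(u)|,
that is 1 - O(n^(-1/4)). So the density is at least rho.
*)

theory Submission
  imports Defs
begin

section \<open>Stochastic domination of random sets\<close>

text \<open>A single site may be empty at time 0, so no comparison site by site is possible, and
  counts have to be pooled over cells. The cell length l is squeezed from two sides: Chernoff needs
  l * eps^2 of order n^(1/8), while replacing the kernel by its minimum over a cell loses about l /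
  sqrt n, which must stay well below eps; n^(1/4) meets both demands. The slack is spent in stages:
  the counts have density factor 1 + eps, the threshold required of a cell is 1 + eps/2, the Poisson
  variable below it has 1 + eps/4, and the kernel loss costs a factor of at least 1 - eps/8. No
  coupling is constructed. Domination is a statement about expectations of decreasing functions of
  random sets, with an additive error that absorbs exceptional events. Laws of random sets are
  identified by the probabilities of lying inside a given set: independent unions become products
  and Poisson numbers of copies become exponentials, so thinning and superposition turn into linear
  identities between exponents.\<close>

lemma integrable_measure_pmf_unit:
  fixes f :: "'a \<Rightarrow> real"
  assumes "\<And>x. f x \<in> {0..1}"
  shows "integrable (measure_pmf p) f"
  using assms by (intro measure_pmf.integrable_const_bound[where B = 1]) auto

lemma expectation_unit:
  fixes f :: "'a \<Rightarrow> real"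
  assumes "\<And>x. f x \<in> {0..1}"
  shows "measure_pmf.expectation p f \<in> {0..1}"
proof -
  have "measure_pmf.expectation p f \<le> measure_pmf.expectation p (\<lambda>_. 1)"
    using assms by (intro integral_mono integrable_measure_pmf_unit) auto
  moreover have "0 \<le> measure_pmf.expectation p f"
    using assms by (intro integral_nonneg_AE) auto
  ultimately show ?thesis by simp
qed

lemma nn_integral_measure_pmf_unit:
  fixes f :: "'a \<Rightarrow> real"
  assumes "\<And>x. f x \<in> {0..1}"
  shows "(\<integral>\<^sup>+x. ennreal (f x) \<partial>measure_pmf p) = ennreal (measure_pmf.expectation p f)"
  using assms by (intro nn_integral_eq_integral integrable_measure_pmf_unit) auto

text \<open>For values in [0,1] the detour through \<open>nn_integral\<close> handles arbitrary
  kernels \<open>g\<close> without summability conditions.\<close>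

lemma expectation_bind_unit:
  fixes f :: "'b \<Rightarrow> real"
  assumes f: "\<And>x. f x \<in> {0..1}"
  shows "measure_pmf.expectation (bind_pmf p g) f =
    measure_pmf.expectation p (\<lambda>x. measure_pmf.expectation (g x) f)"
proof -
  note u = expectation_unit[of f, OF f]
  have "ennreal (measure_pmf.expectation (bind_pmf p g) f) = (\<integral>\<^sup>+x. ennreal (f x) \<partial>bind_pmf p g)"
    by (rule nn_integral_measure_pmf_unit[symmetric]) (rule f)
  also have "\<dots> = (\<integral>\<^sup>+x. \<integral>\<^sup>+y. ennreal (f y) \<partial>g x \<partial>p)"
    by (rule nn_integral_bind_pmf)
  also have "\<dots> = (\<integral>\<^sup>+x. ennreal (measure_pmf.expectation (g x) f) \<partial>p)"
    using f by (intro nn_integral_cong nn_integral_measure_pmf_unit)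
  also have "\<dots> = ennreal (measure_pmf.expectation p (\<lambda>x. measure_pmf.expectation (g x) f))"
    by (intro nn_integral_measure_pmf_unit u)
  finally show ?thesis
    using u expectation_unit[of "\<lambda>x. measure_pmf.expectation (g x) f" p, OF u]
    by (subst (asm) ennreal_inj) auto
qed

lemma
  fixes f :: "'a \<Rightarrow> real"
  assumes "\<And>x. f x \<in> {0..1}"
  shows integrable_unit_add_const: "integrable (measure_pmf p) (\<lambda>x. f x + c)"
    and expectation_unit_add_const:
      "measure_pmf.expectation p (\<lambda>x. f x + c) = measure_pmf.expectation p f + c"
  using integrable_measure_pmf_unit[of f p, OF assms] by simp_all

text \<open>Convolution for the semigroup of sets under union. As a commutative monoid it yields the
  big operator \<open>uconv.F\<close>, the law of the union of a finite independent family.\<close>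

definition uconv :: "'a set pmf \<Rightarrow> 'a set pmf \<Rightarrow> 'a set pmf" where
  "uconv \<mu> \<nu> = bind_pmf \<mu> (\<lambda>X. bind_pmf \<nu> (\<lambda>Y. return_pmf (X \<union> Y)))"

interpretation uconv: comm_monoid_set uconv "return_pmf {}"
proof
  fix a b c :: "'a set pmf"
  show "uconv (uconv a b) c = uconv a (uconv b c)"
    by (simp add: uconv_def bind_assoc_pmf bind_return_pmf Un_assoc)
  show "uconv a b = uconv b a"
    unfolding uconv_def by (subst bind_commute_pmf) (simp add: Un_commute)
  show "uconv a (return_pmf {}) = a"
    by (simp add: uconv_def bind_return_pmf bind_return_pmf')
qed

lemma expectation_uconv:
  fixes \<phi> :: "'a set \<Rightarrow> real"
  assumes "\<And>X. \<phi> X \<in> {0..1}"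
  shows "measure_pmf.expectation (uconv \<mu> \<nu>) \<phi> =
    measure_pmf.expectation \<mu> (\<lambda>X. measure_pmf.expectation \<nu> (\<lambda>Y. \<phi> (X \<union> Y)))"
  using assms by (simp add: uconv_def expectation_bind_unit)

lemma expectation_uconv':
  fixes \<phi> :: "'a set \<Rightarrow> real"
  assumes "\<And>X. \<phi> X \<in> {0..1}"
  shows "measure_pmf.expectation (uconv \<mu> \<nu>) \<phi> =
    measure_pmf.expectation \<nu> (\<lambda>Y. measure_pmf.expectation \<mu> (\<lambda>X. \<phi> (X \<union> Y)))"
  using expectation_uconv[of \<phi> \<nu> \<mu>, OF assms] assms
  by (simp add: uconv.commute[of \<mu>] Un_commute)

text \<open>The zeta transform on the subset lattice, that is, the probability of avoiding the
  complement of \<open>C\<close>. It plays the part of a generating function.\<close>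

definition zeta :: "'a set pmf \<Rightarrow> 'a set \<Rightarrow> real" where
  "zeta \<mu> C = measure_pmf.expectation \<mu> (\<lambda>X. of_bool (X \<subseteq> C))"

lemma zeta_bounds: "0 \<le> zeta \<mu> C" "zeta \<mu> C \<le> 1"
  using expectation_unit[of "\<lambda>X. of_bool (X \<subseteq> C)" \<mu>] by (auto simp: zeta_def)

lemma zeta_return [simp]: "zeta (return_pmf X) C = of_bool (X \<subseteq> C)"
  by (simp add: zeta_def)

lemma zeta_uconv: "zeta (uconv \<mu> \<nu>) C = zeta \<mu> C * zeta \<nu> C"
proof -
  have "zeta (uconv \<mu> \<nu>) C = measure_pmf.expectation \<mu> (\<lambda>X. measure_pmf.expectation \<nu> (\<lambda>Y. of_bool (X \<union> Y \<subseteq> C)))"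
    unfolding zeta_def by (rule expectation_uconv) auto
  also have "\<dots> = measure_pmf.expectation \<mu> (\<lambda>X. of_bool (X \<subseteq> C) * zeta \<nu> C)"
    unfolding zeta_def by (intro Bochner_Integration.integral_cong) auto
  finally show ?thesis by (simp add: zeta_def)
qed

lemma zeta_F: "zeta (uconv.F \<mu> A) C = (\<Prod>i\<in>A. zeta (\<mu> i) C)"
  by (induction A rule: infinite_finite_induct) (auto simp: zeta_uconv)

lemma zeta_bind: "zeta (bind_pmf p \<mu>) C = measure_pmf.expectation p (\<lambda>x. zeta (\<mu> x) C)"
  unfolding zeta_def by (rule expectation_bind_unit) auto

lemma zeta_eq_sum_pmf:
  assumes "finite B" "set_pmf \<mu> \<subseteq> Pow B" "C \<subseteq> B"
  shows "zeta \<mu> C = (\<Sum>X\<in>Pow C. pmf \<mu> X)"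
proof -
  have "finite C" using assms finite_subset by blast
  then show ?thesis
    unfolding zeta_def by (subst integral_measure_pmf[of "Pow C"]) (auto intro!: sum.cong)
qed

text \<open>Moebius inversion as an induction: once all proper subsets of \<open>C\<close> have
  equal mass, the cumulative masses at \<open>C\<close> force equality at \<open>C\<close>
  itself.\<close>

lemma pmf_eqI_zeta:
  assumes "finite B" "set_pmf \<mu> \<subseteq> Pow B" "set_pmf \<nu> \<subseteq> Pow B"
    and eq: "\<And>C. C \<subseteq> B \<Longrightarrow> zeta \<mu> C = zeta \<nu> C"
  shows "\<mu> = \<nu>"
proof (rule pmf_eqI)
  fix C
  show "pmf \<mu> C = pmf \<nu> C"
  proof (cases "C \<subseteq> B")
    case True
    then have "finite C" using assms(1) finite_subset by blast
    from this True show ?thesis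
    proof (induction C rule: finite_psubset_induct)
      case (psubset C)
      have fin: "finite (Pow C)" using psubset.hyps by simp
      have "pmf \<mu> C + (\<Sum>X\<in>Pow C - {C}. pmf \<mu> X) = pmf \<nu> C + (\<Sum>X\<in>Pow C - {C}. pmf \<nu> X)"
        using eq[OF psubset.prems] zeta_eq_sum_pmf[OF assms(1,2) psubset.prems]
          zeta_eq_sum_pmf[OF assms(1,3) psubset.prems]
          sum.remove[OF fin, of C "pmf \<mu>"] sum.remove[OF fin, of C "pmf \<nu>"] by simp
      moreover have "(\<Sum>X\<in>Pow C - {C}. pmf \<mu> X) = (\<Sum>X\<in>Pow C - {C}. pmf \<nu> X)"
        using psubset by (intro sum.cong refl) blast
      ultimately show ?case by simp
    qed
  next
    case False
    then show ?thesis using assms(2,3) by (metis PowD pmf_eq_0_set_pmf subsetD)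
  qed
qed

lemma set_uconv_F:
  assumes "\<And>i. i \<in> A \<Longrightarrow> set_pmf (\<mu> i) \<subseteq> Pow B"
  shows "set_pmf (uconv.F \<mu> A) \<subseteq> Pow B"
  using assms
proof (induction A rule: infinite_finite_induct)
  case (insert i A)
  then have "set_pmf (\<mu> i) \<subseteq> Pow B" "set_pmf (uconv.F \<mu> A) \<subseteq> Pow B" by auto
  then show ?case using insert.hyps by (fastforce simp: uconv_def)
qed auto

text \<open>\<mu> is the law with more points, so decreasing functions have the smaller mean under
  it. The range [0,1] makes an exceptional event cost at most its probability.\<close>

definition dominates_upto :: "real \<Rightarrow> 'a set pmf \<Rightarrow> 'a set pmf \<Rightarrow> bool" where
  "dominates_upto \<delta> \<mu> \<nu> \<longleftrightarrow> (\<forall>\<phi> :: 'a set \<Rightarrow> real. antimono \<phi> \<longrightarrow> (\<forall>X. \<phi> X \<in> {0..1}) \<longrightarrow>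
     measure_pmf.expectation \<mu> \<phi> \<le> measure_pmf.expectation \<nu> \<phi> + \<delta>)"

lemma dominates_uptoD:
  assumes "dominates_upto \<delta> \<mu> \<nu>" "antimono \<phi>" "\<And>X. \<phi> X \<in> {0..1}"
  shows "measure_pmf.expectation \<mu> \<phi> \<le> measure_pmf.expectation \<nu> \<phi> + \<delta>"
  using assms by (auto simp: dominates_upto_def)

lemma dominates_upto_refl: "dominates_upto 0 \<mu> \<mu>"
  by (simp add: dominates_upto_def)

lemma dominates_upto_trans:
  "dominates_upto \<delta> \<mu> \<nu> \<Longrightarrow> dominates_upto \<delta>' \<nu> \<kappa> \<Longrightarrow> dominates_upto (\<delta> + \<delta>') \<mu> \<kappa>"
  unfolding dominates_upto_def by (smt (verit))

lemma dominates_upto_empty: "dominates_upto 0 \<mu> (return_pmf {})"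
  unfolding dominates_upto_def
proof (intro allI impI)
  fix \<phi> :: "'a set \<Rightarrow> real" assume \<phi>: "antimono \<phi>" "\<forall>X. \<phi> X \<in> {0..1}"
  have "measure_pmf.expectation \<mu> \<phi> \<le> measure_pmf.expectation \<mu> (\<lambda>_. \<phi> {})"
    using \<phi> by (intro integral_mono integrable_measure_pmf_unit) (auto dest: antimonoD)
  then show "measure_pmf.expectation \<mu> \<phi> \<le> measure_pmf.expectation (return_pmf {}) \<phi> + 0" by simp
qed

text \<open>One factor is exchanged at a time. Freezing the other set keeps the function antitone,
  and swapping the two integrations brings the factor to be exchanged to the inside.\<close>

lemma dominates_upto_uconv:
  assumes "dominates_upto \<delta> \<mu> \<nu>" "dominates_upto \<delta>' \<mu>' \<nu>'"
  shows "dominates_upto (\<delta> + \<delta>') (uconv \<mu> \<mu>') (uconv \<nu> \<nu>')"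
  unfolding dominates_upto_def
proof (intro allI impI)
  fix \<phi> :: "'a set \<Rightarrow> real" assume \<phi>: "antimono \<phi>" "\<forall>X. \<phi> X \<in> {0..1}"
  have anti: "antimono (\<lambda>Y. \<phi> (X \<union> Y))" "antimono (\<lambda>Y. \<phi> (Y \<union> X))" for X
    using \<phi>(1) by (auto intro!: antimonoI elim!: antimonoD)
  have unit: "measure_pmf.expectation p (\<lambda>Y. \<phi> (X \<union> Y)) \<in> {0..1}" 
    "measure_pmf.expectation p (\<lambda>Y. \<phi> (Y \<union> X)) \<in> {0..1}" for p X
    using \<phi>(2) by (intro expectation_unit; simp)+
  have "measure_pmf.expectation (uconv \<mu> \<mu>') \<phi> =
      measure_pmf.expectation \<mu> (\<lambda>X. measure_pmf.expectation \<mu>' (\<lambda>Y. \<phi> (X \<union> Y)))"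
    using \<phi> by (intro expectation_uconv) auto
  also have "\<dots> \<le> measure_pmf.expectation \<mu> (\<lambda>X. measure_pmf.expectation \<nu>' (\<lambda>Y. \<phi> (X \<union> Y)) + \<delta>')"
    using \<phi>(2) unit anti
    by (intro integral_mono dominates_uptoD[OF assms(2)] integrable_unit_add_const
        integrable_measure_pmf_unit) auto
  also have "\<dots> = measure_pmf.expectation (uconv \<mu> \<nu>') \<phi> + \<delta>'"
    using \<phi> unit by (subst expectation_unit_add_const) (auto simp: expectation_uconv)
  also have "measure_pmf.expectation (uconv \<mu> \<nu>') \<phi> =
      measure_pmf.expectation \<nu>' (\<lambda>Y. measure_pmf.expectation \<mu> (\<lambda>X. \<phi> (X \<union> Y)))"
    using \<phi> by (intro expectation_uconv') auto
  also have "\<dots> \<le> measure_pmf.expectation \<nu>' (\<lambda>Y. measure_pmf.expectation \<nu> (\<lambda>X. \<phi> (X \<union> Y)) + \<delta>)"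
    using \<phi>(2) unit anti
    by (intro integral_mono dominates_uptoD[OF assms(1)] integrable_unit_add_const
        integrable_measure_pmf_unit) auto
  also have "\<dots> = measure_pmf.expectation (uconv \<nu> \<nu>') \<phi> + \<delta>"
    using \<phi> unit by (subst expectation_unit_add_const) (auto simp: expectation_uconv')
  finally show "measure_pmf.expectation (uconv \<mu> \<mu>') \<phi> \<le> measure_pmf.expectation (uconv \<nu> \<nu>') \<phi> + (\<delta> + \<delta>')"
    by simp
qed

lemma dominates_upto_F:
  assumes "\<And>i. i \<in> A \<Longrightarrow> dominates_upto (\<delta> i) (\<mu> i) (\<nu> i)"
  shows "dominates_upto (\<Sum>i\<in>A. \<delta> i) (uconv.F \<mu> A) (uconv.F \<nu> A)"
  using assms
  by (induction A rule: infinite_finite_induct) (auto simp: dominates_upto_refl intro!: dominates_upto_uconv)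

lemma dominates_upto_F_subset:
  assumes "finite A" "A' \<subseteq> A"
  shows "dominates_upto 0 (uconv.F \<mu> A) (uconv.F \<mu> A')"
  using dominates_upto_uconv[OF dominates_upto_empty[of "uconv.F \<mu> (A - A')"] dominates_upto_refl[of "uconv.F \<mu> A'"]]
  by (simp add: uconv.subset_diff[OF assms(2,1)] uconv.left_neutral)

section \<open>Unions of a Poisson number of independent copies\<close>

definition cpois :: "real \<Rightarrow> 'a set pmf \<Rightarrow> 'a set pmf" where
  "cpois m \<nu> = bind_pmf (poisson_pmf m) (\<lambda>k. uconv.F (\<lambda>_. \<nu>) {..<k})"

lemma set_cpois: "set_pmf \<nu> \<subseteq> Pow B \<Longrightarrow> set_pmf (cpois m \<nu>) \<subseteq> Pow B"
  using set_uconv_F[of _ "\<lambda>_. \<nu>" B] by (fastforce simp: cpois_def)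

lemma sums_poisson_pgf:
  assumes "0 < m"
  shows "(\<lambda>k. pmf (poisson_pmf m) k * z ^ k) sums exp (- m * (1 - z))"
proof -
  have "(\<lambda>k. exp (- m) * ((m * z) ^ k /\<^sub>R fact k)) sums (exp (- m) * exp (m * z))"
    by (intro sums_mult exp_converges)
  moreover have "exp (- m) * exp (m * z) = exp (- m * (1 - z))"
    by (simp add: exp_add[symmetric] algebra_simps)
  ultimately show ?thesis
    using assms by (simp add: power_mult_distrib field_simps)
qed

lemma
  assumes "0 < m" "0 \<le> z"
  shows integrable_poisson_pgf: "integrable (measure_pmf (poisson_pmf m)) (\<lambda>k. z ^ k)" (is ?I)
    and expectation_poisson_pgf: "measure_pmf.expectation (poisson_pmf m) (\<lambda>k. z ^ k) = exp (- m * (1 - z))" (is ?E)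
proof -
  have s: "(\<lambda>k. pmf (poisson_pmf m) k * z ^ k) sums exp (- m * (1 - z))"
    by (rule sums_poisson_pgf) fact
  have "integrable (count_space UNIV) (\<lambda>k. pmf (poisson_pmf m) k * z ^ k)"
    using s assms unfolding integrable_count_space_nat_iff by (simp add: sums_iff abs_mult)
  then show ?I by (simp add: measure_pmf_eq_density integrable_density)
  have "measure_pmf.expectation (poisson_pmf m) (\<lambda>k. z ^ k) =
      (\<integral>k. pmf (poisson_pmf m) k * z ^ k \<partial>count_space UNIV)"
    by (simp add: measure_pmf_eq_density integral_density)
  also have "\<dots> = (\<Sum>k. pmf (poisson_pmf m) k * z ^ k)"
    by (rule integral_count_space_nat) fact
  finally show ?E using s by (simp add: sums_iff)
qed

text \<open>All \<open>k\<close> copies lie inside \<open>C\<close> with probability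
  \<open>zeta \<nu> C ^ k\<close>; averaging over \<open>k\<close> gives the Poisson generating
  function.\<close>

lemma zeta_cpois:
  assumes "0 < m"
  shows "zeta (cpois m \<nu>) C = exp (- m * (1 - zeta \<nu> C))"
  using expectation_poisson_pgf[OF assms zeta_bounds(1)[of \<nu> C]]
  by (simp add: cpois_def zeta_bind zeta_F)

text \<open>As long as the Poisson number \<open>k\<close> is at most \<open>M\<close>, the first
  \<open>k\<close> of the \<open>M\<close> copies have the right law and the others only enlarge the
  union; the event \<open>k > M\<close> is paid for in full.\<close>

lemma dominates_upto_cpois:
  "dominates_upto (measure_pmf.prob (poisson_pmf m) {M<..}) (uconv.F (\<lambda>_. \<nu>) {..<M}) (cpois m \<nu>)"
  unfolding dominates_upto_def
proof (intro allI impI)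
  fix \<phi> :: "'a set \<Rightarrow> real" assume \<phi>: "antimono \<phi>" "\<forall>X. \<phi> X \<in> {0..1}"
  let ?P = "poisson_pmf m"
  let ?e = "\<lambda>k. measure_pmf.expectation (uconv.F (\<lambda>_. \<nu>) {..<k}) \<phi>"
  have e: "?e k \<in> {0..1}" for k using \<phi>(2) by (intro expectation_unit) auto
  have "?e M - measure_pmf.prob ?P {M<..} = measure_pmf.expectation ?P (\<lambda>k. ?e M - indicator {M<..} k)"
    by (subst Bochner_Integration.integral_diff)
      (auto intro!: integrable_measure_pmf_unit simp: indicator_def)
  also have "\<dots> \<le> measure_pmf.expectation ?P ?e"
  proof (rule integral_mono)
    fix k
    show "?e M - indicator {M<..} k \<le> ?e k"
    proof (cases "k \<le> M")
      case True
      then show ?thesis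
        using dominates_uptoD[OF dominates_upto_F_subset[of "{..<M}" "{..<k}" "\<lambda>_. \<nu>"] \<phi>(1)] \<phi>(2) by auto
    next
      case False
      then show ?thesis using e[of M] e[of k] by (auto simp: indicator_def)
    qed
  next
    show "integrable ?P (\<lambda>k. ?e M - indicator {M<..} k)"
      by (intro Bochner_Integration.integrable_diff integrable_measure_pmf_unit) (use e in \<open>auto simp: indicator_def\<close>)
    show "integrable ?P ?e" by (intro integrable_measure_pmf_unit e)
  qed
  also have "\<dots> = measure_pmf.expectation (cpois m \<nu>) \<phi>"
    using \<phi>(2) by (auto simp: cpois_def expectation_bind_unit)
  finally show "?e M \<le> measure_pmf.expectation (cpois m \<nu>) \<phi> + measure_pmf.prob ?P {M<..}" by simp
qed

section \<open>Variation of the lazy walk kernel\<close>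

lemma set_step_pmf:
  assumes "0 < q" "q < 1" shows "set_pmf (step_pmf q) \<subseteq> {-1, 0, 1}"
  by (auto simp: step_pmf_def split: if_splits)

lemma pmf_step_pmf:
  assumes "0 < q" "q < 1"
  shows "pmf (step_pmf q) 0 = q" "pmf (step_pmf q) 1 = (1 - q) / 2" "pmf (step_pmf q) (-1) = (1 - q) / 2"
  using assms by (simp_all add: step_pmf_def pmf_bind indicator_def)

text \<open>Chosen so that step probability times score is 1 at 0, -1 at 1 and 0 elsewhere. Under
  the step law it has mean 0 and second moment 1/q + 2/(1-q).\<close>

definition score :: "real \<Rightarrow> int \<Rightarrow> real" where
  "score q j = (if j = 1 then - 2 / (1 - q) else if j = 0 then 1 / q else 0)"

primrec scored_walk :: "real \<Rightarrow> nat \<Rightarrow> (int \<times> real) pmf" where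
  "scored_walk q 0 = return_pmf (0, 0)"
| "scored_walk q (Suc m) =
     bind_pmf (step_pmf q) (\<lambda>j. map_pmf (\<lambda>(x, z). (x + j, z + score q j)) (scored_walk q m))"

context
  fixes q :: real
  assumes q: "0 < q" "q < 1"
begin

lemma finite_set_scored_walk: "finite (set_pmf (scored_walk q m))"
proof (induction m)
  case (Suc m)
  have "finite (set_pmf (step_pmf q))" using set_step_pmf[OF q] by (rule finite_subset) simp
  with Suc show ?case by simp
qed simp

lemma integrable_scored_walk: "integrable (measure_pmf (scored_walk q m)) (f :: _ \<Rightarrow> real)"
  by (rule integrable_measure_pmf_finite[OF finite_set_scored_walk])

lemma expectation_scored_walk_Suc:
  fixes f :: "int \<times> real \<Rightarrow> real"
  shows "measure_pmf.expectation (scored_walk q (Suc m)) f =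
    (1 - q) / 2 * measure_pmf.expectation (scored_walk q m) (\<lambda>(x, z). f (x - 1, z))
    + q * measure_pmf.expectation (scored_walk q m) (\<lambda>(x, z). f (x, z + 1 / q))
    + (1 - q) / 2 * measure_pmf.expectation (scored_walk q m) (\<lambda>(x, z). f (x + 1, z - 2 / (1 - q)))"
  using set_step_pmf[OF q]
  by (simp add: pmf_expectation_bind[where A = "{-1, 0, 1}"] finite_set_scored_walk pmf_step_pmf[OF q]
      score_def case_prod_unfold)

lemma expectation_score:
  "measure_pmf.expectation (scored_walk q m) snd = 0"
proof (induction m)
  case (Suc m)
  note [simp] = integrable_scored_walk
  show ?case
    unfolding expectation_scored_walk_Suc using q Suc
    by (simp add: case_prod_unfold field_simps)
qed simp

text \<open>The accumulated score is centred, so cross terms vanish and every step adds its own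
  second moment.\<close>

lemma expectation_score_square:
  "measure_pmf.expectation (scored_walk q m) (\<lambda>w. (snd w)\<^sup>2) = real m * (1 / q + 2 / (1 - q))"
proof (induction m)
  case (Suc m)
  note [simp] = integrable_scored_walk
  have *: "measure_pmf.expectation (scored_walk q m) (\<lambda>w. (snd w + c)\<^sup>2) =
      real m * (1 / q + 2 / (1 - q)) + c\<^sup>2" for c
  proof -
    have "measure_pmf.expectation (scored_walk q m) (\<lambda>w. (snd w + c)\<^sup>2) =
      measure_pmf.expectation (scored_walk q m) (\<lambda>w. (snd w)\<^sup>2 + 2 * c * snd w + c\<^sup>2)"
      by (intro Bochner_Integration.integral_cong) (auto simp: power2_eq_square algebra_simps)
    also have "\<dots> = real m * (1 / q + 2 / (1 - q)) + c\<^sup>2"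
      using Suc expectation_score[of m] by simp
    finally show ?thesis .
  qed
  have "measure_pmf.expectation (scored_walk q (Suc m)) (\<lambda>w. (snd w)\<^sup>2) =
    (1 - q) / 2 * (real m * (1 / q + 2 / (1 - q))) + q * (real m * (1 / q + 2 / (1 - q)) + (1 / q)\<^sup>2) +
    (1 - q) / 2 * (real m * (1 / q + 2 / (1 - q)) + (- 2 / (1 - q))\<^sup>2)"
    unfolding expectation_scored_walk_Suc using *[of "1 / q"] *[of "- 2 / (1 - q)"] *[of 0]
    by (simp add: case_prod_unfold)
  also have "\<dots> = real m * (1 / q + 2 / (1 - q)) + (q * (1 / q)\<^sup>2 + (1 - q) / 2 * (- 2 / (1 - q))\<^sup>2)"
  proof -
    have "(1 - q) / 2 * V + q * (V + a) + (1 - q) / 2 * (V + b) = V + (q * a + (1 - q) / 2 * b)" for V a b :: real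
      by (simp add: field_simps)
    then show ?thesis .
  qed
  finally have "measure_pmf.expectation (scored_walk q (Suc m)) (\<lambda>w. (snd w)\<^sup>2) =
    real m * (1 / q + 2 / (1 - q)) + (q * (1 / q)\<^sup>2 + (1 - q) / 2 * (- 2 / (1 - q))\<^sup>2)" .
  also have "q * (1 / q)\<^sup>2 + (1 - q) / 2 * (- 2 / (1 - q))\<^sup>2 = 1 / q + 2 / (1 - q)"
    using q by (simp add: power2_eq_square divide_simps) (simp add: algebra_simps)
  finally have "measure_pmf.expectation (scored_walk q (Suc m)) (\<lambda>w. (snd w)\<^sup>2) =
    real m * (1 / q + 2 / (1 - q)) + (1 / q + 2 / (1 - q))" .
  moreover have "real m * V + V = real (Suc m) * V" for V :: real
    by (simp add: algebra_simps)
  ultimately show ?case by (simp only:)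
qed simp

definition srw :: "nat \<Rightarrow> int pmf" where "srw m = map_pmf fst (scored_walk q m)"

lemma pmf_srw: "pmf (srw m) u = measure_pmf.expectation (scored_walk q m) (\<lambda>w. of_bool (fst w = u))"
proof -
  have "pmf (srw m) u = measure_pmf.expectation (srw m) (\<lambda>x. of_bool (x = u))"
    by (subst integral_measure_pmf[of "{u}"]) auto
  then show ?thesis by (simp add: srw_def)
qed

lemma pmf_srw_Suc:
  "pmf (srw (Suc m)) u = (1 - q) / 2 * pmf (srw m) (u + 1) + q * pmf (srw m) u + (1 - q) / 2 * pmf (srw m) (u - 1)"
  unfolding pmf_srw expectation_scored_walk_Suc
  by (simp add: case_prod_unfold algebra_simps)

text \<open>By exchangeability all \<open>Suc m\<close> steps contribute equally, and weighting one
  of them by its score leaves the difference of the \<open>m\<close>-step kernel at \<open>u\<close>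
  and \<open>u - 1\<close>. The induction separates the newest step: \<open>rec\<close> gives its
  contribution, and \<open>pmf_srw_Suc\<close> turns the average of the older ones into increments
  of the longer kernel.\<close>

lemma expectation_score_at:
  "measure_pmf.expectation (scored_walk q (Suc m)) (\<lambda>w. snd w * of_bool (fst w = u)) =
    real (Suc m) * (pmf (srw m) u - pmf (srw m) (u - 1))"
proof -
  define D where "D m u = measure_pmf.expectation (scored_walk q m) (\<lambda>w. snd w * of_bool (fst w = u))" for m u
  note [simp] = integrable_scored_walk
  have shift: "measure_pmf.expectation (scored_walk q m) (\<lambda>w. (snd w + c) * of_bool (fst w = v)) =
      D m v + c * pmf (srw m) v" for c v m
    by (simp add: D_def pmf_srw distrib_right)
  have shift': "measure_pmf.expectation (scored_walk q m) (\<lambda>w. (snd w - c) * of_bool (fst w = v)) =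
      D m v - c * pmf (srw m) v" for c v m
    using shift[of m "- c" v] by simp
  have rec: "D (Suc m) u = (1 - q) / 2 * D m (u + 1) + q * D m u + (1 - q) / 2 * D m (u - 1)
      + (pmf (srw m) u - pmf (srw m) (u - 1))" for m u
  proof -
    have e: "(x - 1 = u) = (x = u + 1)" "(x + 1 = u) = (x = u - 1)" for x u :: int
      by auto
    have "D (Suc m) u = (1 - q) / 2 * D m (u + 1) + q * (D m u + 1 / q * pmf (srw m) u)
      + (1 - q) / 2 * (D m (u - 1) - 2 / (1 - q) * pmf (srw m) (u - 1))"
      unfolding D_def[of "Suc m"] expectation_scored_walk_Suc case_prod_unfold fst_conv snd_conv e
        shift shift' by (simp only: D_def)
    moreover have "q * (D m u + 1 / q * P) = q * D m u + P"
      "(1 - q) / 2 * (E - 2 / (1 - q) * P) = (1 - q) / 2 * E - P" for P E :: real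
      using q by (simp_all add: distrib_left right_diff_distrib)
    ultimately show ?thesis by simp
  qed
  have "D (Suc m) u = real (Suc m) * (pmf (srw m) u - pmf (srw m) (u - 1))"
  proof (induction m arbitrary: u)
    case 0
    then show ?case by (simp add: rec) (simp add: D_def)
  next
    case (Suc m)
    show ?case by (subst rec) (simp only: Suc pmf_srw_Suc, simp add: field_simps)
  qed
  then show ?thesis by (simp add: D_def)
qed

text \<open>Weighting the step distribution \<open>\<pi>\<close> by \<open>score\<close> turns it into \<open>\<delta>\<^sub>0 - \<delta>\<^sub>1\<close>, so the increments of the
  \<open>m\<close>-step kernel are, up to the factor \<open>m + 1\<close>, the conditional expectations of the total score
  of \<open>m + 1\<close> steps given their sum. The total score is centred with variance of order \<open>m\<close>.\<close>

lemma srw_variation: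
  assumes "finite A"
  shows "(\<Sum>u\<in>A. \<bar>pmf (srw m) (u + 1) - pmf (srw m) u\<bar>) \<le> sqrt ((1 / q + 2 / (1 - q)) / real (Suc m))"
proof -
  note [simp] = integrable_scored_walk
  define s where "s = sqrt (real (Suc m) * (1 / q + 2 / (1 - q)))"
  have "0 < 1 / q + 2 / (1 - q)" using q by (intro add_pos_pos) auto
  then have s: "s > 0" by (simp add: s_def del: of_nat_Suc)
  have s2: "s\<^sup>2 = real (Suc m) * (1 / q + 2 / (1 - q))" using q by (auto simp: s_def)
  let ?E = "measure_pmf.expectation (scored_walk q (Suc m))"
  have "real (Suc m) * (\<Sum>u\<in>A. \<bar>pmf (srw m) (u + 1) - pmf (srw m) u\<bar>) =
      (\<Sum>u\<in>A. \<bar>?E (\<lambda>w. snd w * of_bool (fst w = u + 1))\<bar>)"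
    by (simp add: expectation_score_at sum_distrib_left abs_mult del: scored_walk.simps of_nat_Suc)
  also have "\<dots> \<le> (\<Sum>u\<in>A. ?E (\<lambda>w. \<bar>snd w\<bar> * of_bool (fst w = u + 1)))"
    by (intro sum_mono order.trans[OF integral_abs_bound]) (simp add: abs_mult del: scored_walk.simps)
  also have "\<dots> = ?E (\<lambda>w. \<Sum>u\<in>A. \<bar>snd w\<bar> * of_bool (fst w = u + 1))"
    by (simp del: scored_walk.simps)
  also have "\<dots> \<le> ?E (\<lambda>w. \<bar>snd w\<bar>)"
  proof (intro integral_mono)
    fix w :: "int \<times> real"
    have "(\<Sum>u\<in>A. of_bool (fst w = u + 1) :: real) = (\<Sum>u\<in>A \<inter> {fst w - 1}. 1)"
      using assms by (intro sum.mono_neutral_cong_right) auto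
    also have "\<dots> \<le> (\<Sum>u\<in>{fst w - 1}. 1)" by (intro sum_mono2) auto
    finally have "(\<Sum>u\<in>A. of_bool (fst w = u + 1) :: real) \<le> 1" by simp
    from mult_left_mono[OF this, of "\<bar>snd w\<bar>"]
    show "(\<Sum>u\<in>A. \<bar>snd w\<bar> * of_bool (fst w = u + 1)) \<le> \<bar>snd w\<bar>" by (simp add: sum_distrib_left)
  qed (simp_all del: scored_walk.simps)
  \<comment> \<open>Cauchy-Schwarz in the form |z| \<le> z^2/(2s) + s/2; with \<open>s\<close> the
    standard deviation of the score, each term has mean s/2.\<close>
  also have "\<dots> \<le> ?E (\<lambda>w. (snd w)\<^sup>2 / (2 * s) + s / 2)"
  proof (intro integral_mono)
    fix w :: "int \<times> real"
    have "0 \<le> (\<bar>snd w\<bar> - s)\<^sup>2" by simp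
    then show "\<bar>snd w\<bar> \<le> (snd w)\<^sup>2 / (2 * s) + s / 2"
      using s by (simp add: field_simps power2_eq_square)
  qed (simp_all del: scored_walk.simps)
  also have "\<dots> = s\<^sup>2 / (2 * s) + s / 2"
    using expectation_score_square[of "Suc m"] s2 by (simp del: scored_walk.simps)
  also have "\<dots> = s" using s by (simp add: power2_eq_square)
  finally have "(\<Sum>u\<in>A. \<bar>pmf (srw m) (u + 1) - pmf (srw m) u\<bar>) \<le> s / real (Suc m)"
    by (simp add: field_simps)
  also have "s / real (Suc m) = sqrt ((1 / q + 2 / (1 - q)) / real (Suc m))"
  proof -
    have "s / real (Suc m) = sqrt (s\<^sup>2 / (real (Suc m))\<^sup>2)"
      using s by (simp add: real_sqrt_divide)
    also have "s\<^sup>2 / (real (Suc m))\<^sup>2 = (1 / q + 2 / (1 - q)) / real (Suc m)"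
      unfolding s2 by (simp add: power2_eq_square del: of_nat_Suc)
    finally show ?thesis .
  qed
  finally show ?thesis .
qed

text \<open>Ties the recursive kernel to the sums of independent steps from which the walks are
  built.\<close>

lemma srw_eq_sum_Pi_pmf:
  "srw m = map_pmf (\<lambda>s. sum s {0..<int m}) (Pi_pmf {0..<int m} 0 (\<lambda>_. step_pmf q))"
proof (induction m)
  case 0
  then show ?case by (simp add: srw_def)
next
  case (Suc m)
  have ins: "{0..<int (Suc m)} = insert (int m) {0..<int m}" by auto
  have "srw (Suc m) = bind_pmf (step_pmf q) (\<lambda>j. map_pmf (\<lambda>x. x + j) (srw m))"
    by (simp add: srw_def map_bind_pmf pmf.map_comp o_def case_prod_unfold)
  also have "\<dots> = map_pmf (\<lambda>(j, s). sum s {0..<int m} + j)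
      (pair_pmf (step_pmf q) (Pi_pmf {0..<int m} 0 (\<lambda>_. step_pmf q)))"
    unfolding Suc by (simp add: pair_pmf_def map_bind_pmf map_pmf_def bind_assoc_pmf bind_return_pmf)
  also have "\<dots> = map_pmf (\<lambda>s. sum s {0..<int (Suc m)}) (Pi_pmf {0..<int (Suc m)} 0 (\<lambda>_. step_pmf q))"
    unfolding ins by (subst Pi_pmf_insert) (auto simp: pmf.map_comp o_def case_prod_unfold intro!: map_pmf_cong)
  finally show ?case .
qed

lemma set_srw: "set_pmf (srw m) \<subseteq> {- int m..int m}"
proof (induction m)
  case (Suc m)
  have *: "srw (Suc m) = bind_pmf (step_pmf q) (\<lambda>j. map_pmf (\<lambda>x. x + j) (srw m))"
    by (simp add: srw_def map_bind_pmf pmf.map_comp o_def case_prod_unfold)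
  show ?case unfolding * using Suc set_step_pmf[OF q]
    by (force simp: subset_iff)
qed (simp add: srw_def)

end

section \<open>Comparing dense cells with a Poisson cloud\<close>

text \<open>Written as a deficit from \<open>\<phi> {}\<close>: draws outside \<open>Y\<close> cause
  no deficit, so a finite sum remains even if \<open>p\<close> has infinite support.\<close>

lemma expectation_bind_trivial_off:
  fixes \<phi> :: "'a set \<Rightarrow> real"
  assumes \<phi>: "\<And>X. \<phi> X \<in> {0..1}" and "finite Y" "\<And>y. y \<notin> Y \<Longrightarrow> \<kappa> y = return_pmf {}"
  shows "measure_pmf.expectation (bind_pmf p \<kappa>) \<phi> =
    \<phi> {} - (\<Sum>y\<in>Y. pmf p y * (\<phi> {} - measure_pmf.expectation (\<kappa> y) \<phi>))"
proof -
  let ?h = "\<lambda>y. measure_pmf.expectation (\<kappa> y) \<phi>"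
  have h: "?h y \<in> {0..1}" for y by (intro expectation_unit \<phi>)
  have "measure_pmf.expectation (bind_pmf p \<kappa>) \<phi> = measure_pmf.expectation p ?h"
    by (intro expectation_bind_unit \<phi>)
  also have "\<dots> = \<phi> {} - measure_pmf.expectation p (\<lambda>y. \<phi> {} - ?h y)"
    using integrable_measure_pmf_unit[of ?h p, OF h] by simp
  also have "measure_pmf.expectation p (\<lambda>y. \<phi> {} - ?h y) = (\<Sum>y\<in>Y. pmf p y * (\<phi> {} - ?h y))"
    using assms(2,3) by (subst integral_measure_pmf[of Y]) fastforce+
  finally show ?thesis .
qed

text \<open>A draw at \<open>y\<close> is kept so that kept points have mass \<open>g y\<close>; a
  rejected draw leaves the empty set. For \<open>g\<close> below \<open>pmf p\<close> the result
  depends on \<open>p\<close> only through \<open>g\<close>, so different starting points can share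
  one thinned law.\<close>

definition thin :: "'a pmf \<Rightarrow> ('a \<Rightarrow> real) \<Rightarrow> ('a \<Rightarrow> 'b set pmf) \<Rightarrow> 'b set pmf" where
  "thin p g \<kappa> = bind_pmf p (\<lambda>y. bind_pmf (bernoulli_pmf (g y / pmf p y))
     (\<lambda>b. if b then \<kappa> y else return_pmf {}))"

lemma expectation_thin:
  fixes \<phi> :: "'b set \<Rightarrow> real"
  assumes \<phi>: "\<And>X. \<phi> X \<in> {0..1}" and Y: "finite Y" "\<And>y. y \<notin> Y \<Longrightarrow> \<kappa> y = return_pmf {}"
    and g: "\<And>y. 0 \<le> g y" "\<And>y. g y \<le> pmf p y"
  shows "measure_pmf.expectation (thin p g \<kappa>) \<phi> =
    \<phi> {} - (\<Sum>y\<in>Y. g y * (\<phi> {} - measure_pmf.expectation (\<kappa> y) \<phi>))"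
proof -
  let ?\<kappa> = "\<lambda>y. bind_pmf (bernoulli_pmf (g y / pmf p y)) (\<lambda>b. if b then \<kappa> y else return_pmf {})"
  have r: "g y / pmf p y \<in> {0..1}" for y
    using g[of y] by (auto simp: divide_le_eq_1)
  have "measure_pmf.expectation (thin p g \<kappa>) \<phi> =
    \<phi> {} - (\<Sum>y\<in>Y. pmf p y * (\<phi> {} - measure_pmf.expectation (?\<kappa> y) \<phi>))"
    unfolding thin_def using Y by (intro expectation_bind_trivial_off \<phi>) (simp_all cong: if_cong)
  also have "(\<Sum>y\<in>Y. pmf p y * (\<phi> {} - measure_pmf.expectation (?\<kappa> y) \<phi>)) =
      (\<Sum>y\<in>Y. g y * (\<phi> {} - measure_pmf.expectation (\<kappa> y) \<phi>))"
  proof (intro sum.cong refl)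
    fix y
    let ?r = "g y / pmf p y"
    have "measure_pmf.expectation (?\<kappa> y) \<phi> =
        ?r * measure_pmf.expectation (\<kappa> y) \<phi> + (1 - ?r) * \<phi> {}"
      using r[of y] by (subst expectation_bind_unit[OF \<phi>]) (simp_all add: algebra_simps)
    then have "\<phi> {} - measure_pmf.expectation (?\<kappa> y) \<phi> = ?r * (\<phi> {} - measure_pmf.expectation (\<kappa> y) \<phi>)"
      by (simp add: algebra_simps)
    \<comment> \<open>Where \<open>pmf p y\<close> is 0, so is \<open>g y\<close>, and the quotient
      0/0 = 0 does no harm.\<close>
    moreover have "pmf p y * ?r = g y" using g[of y] by (cases "pmf p y = 0") auto
    ultimately show "pmf p y * (\<phi> {} - measure_pmf.expectation (?\<kappa> y) \<phi>) =
        g y * (\<phi> {} - measure_pmf.expectation (\<kappa> y) \<phi>)"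
      by (metis mult.assoc)
  qed
  finally show ?thesis .
qed

lemma set_thin: "(\<And>y. set_pmf (\<kappa> y) \<subseteq> Pow B) \<Longrightarrow> set_pmf (thin p g \<kappa>) \<subseteq> Pow B"
  by (fastforce simp: thin_def split: if_splits)

text \<open>Both laws contain the mass \<open>g\<close>; the rest of \<open>p'\<close> produces some
  set where the thinned law has the empty one.\<close>

lemma dominates_upto_thin:
  assumes Y: "finite Y" "\<And>y. y \<notin> Y \<Longrightarrow> \<kappa> y = return_pmf {}"
    and g: "\<And>y. 0 \<le> g y" "\<And>y. g y \<le> pmf p y" "\<And>y. g y \<le> pmf p' y"
  shows "dominates_upto 0 (bind_pmf p' \<kappa>) (thin p g \<kappa>)"
  unfolding dominates_upto_def
proof (intro allI impI)
  fix \<phi> :: "'b set \<Rightarrow> real" assume \<phi>: "antimono \<phi>" "\<forall>X. \<phi> X \<in> {0..1}"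
  have "(\<Sum>y\<in>Y. g y * (\<phi> {} - measure_pmf.expectation (\<kappa> y) \<phi>))
      \<le> (\<Sum>y\<in>Y. pmf p' y * (\<phi> {} - measure_pmf.expectation (\<kappa> y) \<phi>))"
    using dominates_uptoD[OF dominates_upto_empty \<phi>(1)] \<phi>(2)
    by (intro sum_mono mult_right_mono g) auto
  then show "measure_pmf.expectation (bind_pmf p' \<kappa>) \<phi> \<le> measure_pmf.expectation (thin p g \<kappa>) \<phi> + 0"
    using expectation_thin[of \<phi> Y \<kappa> g p] expectation_bind_trivial_off[of \<phi> Y \<kappa> p'] \<phi> Y g by simp
qed

lemma abs_diff_le_variation:
  fixes f :: "int \<Rightarrow> real"
  assumes "u \<le> w"
  shows "\<bar>f w - f u\<bar> \<le> (\<Sum>i\<in>{u..<w}. \<bar>f (i + 1) - f i\<bar>)"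
  using assms
proof (induction w rule: int_ge_induct)
  case (step w)
  have "{u..<w + 1} = insert w {u..<w}" using step.hyps by auto
  then show ?case using step.IH by simp
qed simp

section \<open>Cells and minima over cells\<close>

definition cell :: "int \<Rightarrow> nat \<Rightarrow> nat \<Rightarrow> int set" where
  "cell x0 l j = {x0 + int (j * l)..<x0 + int (Suc j * l)}"

lemma cell_disjoint: "i \<noteq> j \<Longrightarrow> cell x0 l i \<inter> cell x0 l j = {}"
proof (induction i j rule: linorder_wlog)
  case (le i j)
  then have "Suc i * l \<le> j * l" by (intro mult_le_mono1) simp
  then have "int (Suc i * l) \<le> int (j * l)" by (simp only: of_nat_le_iff)
  then show ?case by (auto simp: cell_def simp del: of_nat_mult)
qed (metis Int_commute)

lemma UN_cell: "(\<Union>j<R. cell x0 l j) = {x0..<x0 + int (R * l)}"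
proof (induction R)
  case (Suc R)
  have "{x0..<x0 + int (Suc R * l)} = {x0..<x0 + int (R * l)} \<union> cell x0 l R"
  proof -
    obtain t where t: "t = int (R * l)" "0 \<le> t" by simp
    have "int (Suc R * l) = t + int l" by (simp add: t)
    then show ?thesis using t(2) by (auto simp: cell_def t(1)[symmetric] simp del: of_nat_mult mult_Suc)
  qed
  then show ?case using Suc by (simp add: lessThan_Suc Un_commute)
qed simp

lemma finite_cell [simp]: "finite (cell x0 l j)" and card_cell [simp]: "card (cell x0 l j) = l"
  by (simp_all add: cell_def)

lemma sum_cells:
  "(\<Sum>z\<in>{x0..<x0 + int (R * l)}. f z) = (\<Sum>j<R. \<Sum>z\<in>cell x0 l j. f z :: real)"
  unfolding UN_cell[symmetric] by (subst sum.UNION_disjoint) (auto dest: cell_disjoint)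

text \<open>For a displacement kernel \<open>f\<close>, \<open>f (y - z)\<close> is the probability
  of moving from \<open>z\<close> to \<open>y\<close>, so the minimum is the mass at
  \<open>y\<close> common to all starting sites in \<open>I\<close>.\<close>

definition cell_min :: "(int \<Rightarrow> real) \<Rightarrow> int set \<Rightarrow> int \<Rightarrow> real" where
  "cell_min f I y = Min ((\<lambda>z. f (y - z)) ` I)"

lemma cell_min_le: "finite I \<Longrightarrow> z \<in> I \<Longrightarrow> cell_min f I y \<le> f (y - z)"
  by (simp add: cell_min_def)

lemma cell_min_attained: "finite I \<Longrightarrow> I \<noteq> {} \<Longrightarrow> \<exists>z\<in>I. cell_min f I y = f (y - z)"
  unfolding cell_min_def using Min_in[of "(\<lambda>z. f (y - z)) ` I"] by (metis (no_types, lifting) finite_imageI imageE image_is_empty)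

text \<open>Replacing a function by its minimum on each cell costs at most the cell length times the
  total variation of the function.\<close>

lemma sum_cell_min_ge:
  fixes f :: "int \<Rightarrow> real"
  assumes l: "0 < l" and v: "\<And>A. finite A \<Longrightarrow> (\<Sum>u\<in>A. \<bar>f (u + 1) - f u\<bar>) \<le> v"
  shows "(\<Sum>z\<in>{x0..<x0 + int (R * l)}. f (y - z)) - real l * v
    \<le> (\<Sum>j<R. real l * cell_min f (cell x0 l j) y)"
proof -
  define h where "h z = \<bar>f (y - (z + 1)) - f (y - z)\<bar>" for z
  have ne: "cell x0 l j \<noteq> {}" for j using l card_cell[of x0 l j] by (metis card.empty less_numeral_extra(3))
  \<comment> \<open>The gap to the minimum is bounded by the variation between \<open>z\<close> and
    a minimising site, hence by that over the whole cell. Summing over the \<open>l\<close> sites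
    \<open>z\<close> produces the factor \<open>l\<close>.\<close>
  have diff: "f (y - z) - cell_min f (cell x0 l j) y \<le> (\<Sum>i\<in>cell x0 l j. h i)" if "z \<in> cell x0 l j" for z j
  proof -
    obtain z' where z': "z' \<in> cell x0 l j" "cell_min f (cell x0 l j) y = f (y - z')"
      using cell_min_attained[OF finite_cell ne] by blast
    have "\<bar>f (y - z) - f (y - z')\<bar> \<le> (\<Sum>i\<in>{min z z'..<max z z'}. h i)"
      using abs_diff_le_variation[of "min z z'" "max z z'" "\<lambda>i. f (y - i)"]
      unfolding h_def by (auto simp: min_def max_def abs_minus_commute split: if_splits)
    also have "\<dots> \<le> (\<Sum>i\<in>cell x0 l j. h i)"
      using that z'(1) by (intro sum_mono2) (auto simp: cell_def h_def)
    finally show ?thesis using z'(2) by linarith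
  qed
  have "(\<Sum>z\<in>{x0..<x0 + int (R * l)}. f (y - z)) - (\<Sum>j<R. real l * cell_min f (cell x0 l j) y)
      = (\<Sum>j<R. \<Sum>z\<in>cell x0 l j. f (y - z) - cell_min f (cell x0 l j) y)"
    by (simp only: sum_cells sum_subtractf sum_constant card_cell)
  also have "\<dots> \<le> (\<Sum>j<R. \<Sum>z\<in>cell x0 l j. \<Sum>i\<in>cell x0 l j. h i)"
    by (intro sum_mono diff)
  also have "\<dots> = real l * (\<Sum>i\<in>{x0..<x0 + int (R * l)}. h i)"
    by (simp only: sum_cells sum_constant card_cell sum_distrib_left)
  also have "(\<Sum>i\<in>{x0..<x0 + int (R * l)}. h i) =
      (\<Sum>u\<in>(\<lambda>i. y - (i + 1)) ` {x0..<x0 + int (R * l)}. \<bar>f (u + 1) - f u\<bar>)"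
    by (subst sum.reindex) (auto simp: inj_on_def h_def abs_minus_commute algebra_simps)
  also have "\<dots> \<le> v" by (intro v) simp
  finally show ?thesis using l by simp
qed

lemma pmf_map_translate: "pmf (map_pmf (\<lambda>d. z + d) p) y = pmf p (y - z)" for y z :: int
  using pmf_map_inj'[of "\<lambda>d. z + d" p "y - z"] by (simp add: inj_on_def)

lemma uconv_F_const:
  assumes "finite A"
  shows "uconv.F (\<lambda>_. \<nu>) A = uconv.F (\<lambda>_. \<nu>) {..<card A}"
proof -
  obtain h where "bij_betw h {..<card A} A"
    using ex_bij_betw_nat_finite[OF assms] by (auto simp: atLeast0LessThan)
  from uconv.reindex_bij_betw[OF this, of "\<lambda>_. \<nu>"] show ?thesis by simp
qed

text \<open>In the application \<open>p\<close> is the kernel from time 0 to \<open>n\<close>, and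
  \<open>\<kappa> y\<close> is the law of the trace in the box of a walk that is at \<open>y\<close>
  at time \<open>n\<close>.\<close>

definition particle :: "int pmf \<Rightarrow> (int \<Rightarrow> 'a set pmf) \<Rightarrow> int \<Rightarrow> 'a set pmf" where
  "particle p \<kappa> z = bind_pmf (map_pmf (\<lambda>d. z + d) p) \<kappa>"

text \<open>The part of the particle law common to a whole cell. The first site of the cell only
  supplies a law to be thinned; any other site would give the same result.\<close>

definition cell_particle :: "int pmf \<Rightarrow> (int \<Rightarrow> 'a set pmf) \<Rightarrow> int \<Rightarrow> nat \<Rightarrow> nat \<Rightarrow> 'a set pmf" where
  "cell_particle p \<kappa> x0 l j =
     thin (map_pmf (\<lambda>d. (x0 + int (j * l)) + d) p) (cell_min (pmf p) (cell x0 l j)) \<kappa>"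

context
  fixes p :: "int pmf" and \<kappa> :: "int \<Rightarrow> 'a set pmf" and Y :: "int set" and B :: "'a set"
    and v \<rho> \<theta> :: real and x0 :: int and l R :: nat
  assumes v: "\<And>A. finite A \<Longrightarrow> (\<Sum>u\<in>A. \<bar>pmf p (u + 1) - pmf p u\<bar>) \<le> v"
    and Y: "finite Y" "\<And>y. y \<notin> Y \<Longrightarrow> \<kappa> y = return_pmf {}"
    and B: "finite B" "\<And>y. set_pmf (\<kappa> y) \<subseteq> Pow B"
    and cover: "\<And>y d. y \<in> Y \<Longrightarrow> d \<in> set_pmf p \<Longrightarrow> y - d \<in> {x0..<x0 + int (R * l)}"
    and l: "0 < l" and \<rho>: "0 < \<rho>" "\<rho> \<le> \<theta> * (1 - real l * v)" and \<theta>: "0 < \<theta>"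
begin

lemma first_in_cell: "x0 + int (j * l) \<in> cell x0 l j"
  using l by (simp add: cell_def)

lemma cell_min_pmf_nonneg: "0 \<le> cell_min (pmf p) (cell x0 l j) y"
  using first_in_cell[of j] unfolding cell_min_def by (subst Min_ge_iff) auto

lemma dominates_cell_particle:
  "z \<in> cell x0 l j \<Longrightarrow> dominates_upto 0 (particle p \<kappa> z) (cell_particle p \<kappa> x0 l j)"
  unfolding particle_def cell_particle_def
  using Y cell_min_pmf_nonneg first_in_cell[of j]
  by (intro dominates_upto_thin[of Y]) (auto simp: pmf_map_translate intro!: cell_min_le simp del: of_nat_mult)

lemma zeta_particle:
  "1 - zeta (particle p \<kappa> z) C = (\<Sum>y\<in>Y. pmf p (y - z) * (1 - zeta (\<kappa> y) C))"
  unfolding zeta_def particle_def using Y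
  by (subst expectation_bind_trivial_off[of _ Y]) (auto simp: pmf_map_translate)

lemma zeta_cell_particle:
  "1 - zeta (cell_particle p \<kappa> x0 l j) C =
    (\<Sum>y\<in>Y. cell_min (pmf p) (cell x0 l j) y * (1 - zeta (\<kappa> y) C))"
  unfolding zeta_def cell_particle_def using Y cell_min_pmf_nonneg first_in_cell[of j]
  by (subst expectation_thin[of _ Y]) (auto simp: pmf_map_translate intro!: cell_min_le simp del: of_nat_mult)

text \<open>Invariance of counting measure: by \<open>cover\<close> every start from which
  \<open>y\<close> can be reached lies in the interval, so density \<rho> at time 0 gives density
  exactly \<rho> on \<open>Y\<close> after the displacement.\<close>

lemma sum_kernel_eq_1:
  assumes "y \<in> Y"
  shows "(\<Sum>z\<in>{x0..<x0 + int (R * l)}. pmf p (y - z)) = 1"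
proof -
  have "(\<Sum>z\<in>{x0..<x0 + int (R * l)}. pmf p (y - z)) =
      (\<Sum>d\<in>(\<lambda>z. y - z) ` {x0..<x0 + int (R * l)}. pmf p d)"
    by (subst sum.reindex) (auto simp: inj_on_def)
  also have "\<dots> = 1"
  proof (rule sum_pmf_eq_1)
    show "set_pmf p \<subseteq> (\<lambda>z. y - z) ` {x0..<x0 + int (R * l)}"
      using cover[OF assms] by (force simp: image_iff)
  qed simp
  finally show ?thesis .
qed

text \<open>Superposition: the thinned cells produce at each \<open>y\<close> a cloud of intensity
  at least \<rho>, and the surplus \<open>r y\<close> splits off as an independent cloud that may be
  dropped.\<close>

lemma poisson_cells_dominate:
  "dominates_upto 0 (uconv.F (\<lambda>j. cpois (\<theta> * real l) (cell_particle p \<kappa> x0 l j)) {..<R})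
    (uconv.F (\<lambda>z. cpois \<rho> (particle p \<kappa> z)) {x0..<x0 + int (R * l)})"
proof -
  let ?J = "{x0..<x0 + int (R * l)}"
  define r where "r y = \<theta> * (\<Sum>j<R. real l * cell_min (pmf p) (cell x0 l j) y) - \<rho>" for y
  have r: "0 \<le> r y" if "y \<in> Y" for y
  proof -
    have "\<rho> \<le> \<theta> * (1 - real l * v)" by (rule \<rho>)
    also have "\<dots> \<le> \<theta> * (\<Sum>j<R. real l * cell_min (pmf p) (cell x0 l j) y)"
      using sum_cell_min_ge[where f = "pmf p" and y = y and ?x0.0 = x0 and R = R, OF l v] sum_kernel_eq_1[OF that] \<theta> by (intro mult_left_mono) auto
    finally show ?thesis by (simp add: r_def)
  qed
  let ?P = "uconv.F (\<lambda>z. cpois \<rho> (particle p \<kappa> z)) ?J"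
  \<comment> \<open>Sites without surplus are left out since \<open>zeta_cpois\<close> asks for a
    positive rate; in the exponent they contribute 0.\<close>
  let ?E = "uconv.F (\<lambda>y. cpois (r y) (\<kappa> y)) {y \<in> Y. 0 < r y}"
  let ?L = "uconv.F (\<lambda>j. cpois (\<theta> * real l) (cell_particle p \<kappa> x0 l j)) {..<R}"
  \<comment> \<open>All transforms are exponentials of sums over \<open>Y\<close> with weights
    \<open>e y\<close>, so equality of laws reduces to adding intensities at each
    \<open>y\<close>.\<close>
  have "?L = uconv ?E ?P"
  proof (rule pmf_eqI_zeta[OF B(1)])
    have "set_pmf (particle p \<kappa> z) \<subseteq> Pow B" for z using B(2) by (fastforce simp: particle_def)
    moreover have "set_pmf (cell_particle p \<kappa> x0 l j) \<subseteq> Pow B" for j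
      unfolding cell_particle_def by (rule set_thin[OF B(2)])
    ultimately have "set_pmf ?E \<subseteq> Pow B" "set_pmf ?P \<subseteq> Pow B" "set_pmf ?L \<subseteq> Pow B"
      by (intro set_uconv_F set_cpois B(2); simp)+
    then show "set_pmf ?L \<subseteq> Pow B" "set_pmf (uconv ?E ?P) \<subseteq> Pow B"
      by (auto simp: uconv_def)
  next
    fix C
    define e where "e y = 1 - zeta (\<kappa> y) C" for y
    have zE: "zeta ?E C = exp (\<Sum>y\<in>Y. - (r y * e y))"
    proof -
      have "zeta ?E C = (\<Prod>y\<in>{y \<in> Y. 0 < r y}. exp (- (r y * e y)))"
        unfolding zeta_F by (intro prod.cong) (auto simp: zeta_cpois e_def)
      also have "\<dots> = exp (\<Sum>y\<in>{y \<in> Y. 0 < r y}. - (r y * e y))"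
        using Y(1) by (simp add: exp_sum)
      also have "(\<Sum>y\<in>{y \<in> Y. 0 < r y}. - (r y * e y)) = (\<Sum>y\<in>Y. - (r y * e y))"
        using Y(1) r by (intro sum.mono_neutral_left) force+
      finally show ?thesis .
    qed
    have zP: "zeta ?P C = exp (\<Sum>y\<in>Y. - (\<rho> * e y))"
    proof -
      have "zeta ?P C = exp (\<Sum>z\<in>?J. - (\<rho> * (\<Sum>y\<in>Y. pmf p (y - z) * e y)))"
        by (simp add: zeta_F zeta_cpois \<rho> zeta_particle exp_sum e_def)
      also have "(\<Sum>z\<in>?J. - (\<rho> * (\<Sum>y\<in>Y. pmf p (y - z) * e y))) =
          (\<Sum>z\<in>?J. \<Sum>y\<in>Y. - (\<rho> * e y) * pmf p (y - z))"
        by (simp add: sum_distrib_left sum_negf mult_ac)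
      also have "\<dots> = (\<Sum>y\<in>Y. - (\<rho> * e y) * (\<Sum>z\<in>?J. pmf p (y - z)))"
        by (subst sum.swap) (simp add: sum_distrib_left)
      also have "\<dots> = (\<Sum>y\<in>Y. - (\<rho> * e y))"
        using sum_kernel_eq_1 by (intro sum.cong) auto
      finally show ?thesis .
    qed
    have zL: "zeta ?L C = exp (\<Sum>y\<in>Y. - ((r y + \<rho>) * e y))"
    proof -
      have "zeta ?L C = exp (\<Sum>j<R. - (\<theta> * real l * (\<Sum>y\<in>Y. cell_min (pmf p) (cell x0 l j) y * e y)))"
        using \<theta> l by (simp add: zeta_F zeta_cpois zeta_cell_particle exp_sum e_def)
      also have "(\<Sum>j<R. - (\<theta> * real l * (\<Sum>y\<in>Y. cell_min (pmf p) (cell x0 l j) y * e y))) =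
          (\<Sum>j<R. \<Sum>y\<in>Y. - (\<theta> * (real l * cell_min (pmf p) (cell x0 l j) y) * e y))"
        by (simp add: sum_distrib_left sum_negf mult_ac)
      also have "\<dots> = (\<Sum>y\<in>Y. - ((r y + \<rho>) * e y))"
        by (subst sum.swap) (simp add: sum_distrib_left sum_distrib_right sum_negf r_def)
      finally show ?thesis .
    qed
    show "zeta ?L C = zeta (uconv ?E ?P) C"
      unfolding zeta_uconv zE zP zL by (simp add: exp_add[symmetric] sum.distrib[symmetric] algebra_simps)
  qed
  then show ?thesis
    using dominates_upto_uconv[OF dominates_upto_empty[of ?E] dominates_upto_refl[of ?P]]
    by (simp add: uconv.left_neutral)
qed

text \<open>In each cell \<open>M\<close> particles are selected and the others dropped, each
  selected one is replaced by the common law of the cell, and the fixed number \<open>M\<close> is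
  exchanged for a Poisson number. Only the last exchange has a cost, once per cell.\<close>

lemma dense_cells_dominate_poisson:
  assumes M: "\<And>j. j < R \<Longrightarrow> M \<le> (\<Sum>x\<in>cell x0 l j. N x)"
  shows "dominates_upto (real R * measure_pmf.prob (poisson_pmf (\<theta> * real l)) {M<..})
    (uconv.F (\<lambda>(x, k). particle p \<kappa> x) (SIGMA x:{x0..<x0 + int (R * l)}. {..<N x}))
    (uconv.F (\<lambda>z. cpois \<rho> (particle p \<kappa> z)) {x0..<x0 + int (R * l)})"
proof -
  define K where "K j = (SIGMA x:cell x0 l j. {..<N x})" for j
  let ?\<delta> = "measure_pmf.prob (poisson_pmf (\<theta> * real l)) {M<..}"
  have cell: "dominates_upto ?\<delta> (uconv.F (\<lambda>(x, k). particle p \<kappa> x) (K j)) (cpois (\<theta> * real l) (cell_particle p \<kappa> x0 l j))"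
    if "j < R" for j
  proof -
    have finK: "finite (K j)" by (simp add: K_def)
    have "M \<le> card (K j)" using M[OF that] by (simp add: K_def)
    then obtain K' where K': "K' \<subseteq> K j" "card K' = M" "finite K'"
      using obtain_subset_with_card_n by metis
    have "dominates_upto 0 (uconv.F (\<lambda>(x, k). particle p \<kappa> x) (K j)) (uconv.F (\<lambda>(x, k). particle p \<kappa> x) K')"
      by (rule dominates_upto_F_subset[OF finK K'(1)])
    moreover have "dominates_upto (\<Sum>_\<in>K'. 0) (uconv.F (\<lambda>(x, k). particle p \<kappa> x) K') (uconv.F (\<lambda>_. cell_particle p \<kappa> x0 l j) K')"
      using K'(1) by (intro dominates_upto_F) (auto simp: K_def intro: dominates_cell_particle)
    moreover have "dominates_upto ?\<delta> (uconv.F (\<lambda>_. cell_particle p \<kappa> x0 l j) K') (cpois (\<theta> * real l) (cell_particle p \<kappa> x0 l j))"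
      unfolding uconv_F_const[OF K'(3)] K'(2) by (rule dominates_upto_cpois)
    ultimately show ?thesis by (fastforce dest: dominates_upto_trans)
  qed
  have "(SIGMA x:{x0..<x0 + int (R * l)}. {..<N x}) = (\<Union>j<R. K j)"
    unfolding UN_cell[symmetric] K_def by auto
  then have "uconv.F (\<lambda>(x, k). particle p \<kappa> x) (SIGMA x:{x0..<x0 + int (R * l)}. {..<N x}) =
      uconv.F (\<lambda>j. uconv.F (\<lambda>(x, k). particle p \<kappa> x) (K j)) {..<R}"
    using cell_disjoint[of _ _ x0 l] by (simp, subst uconv.UNION_disjoint) (auto simp: K_def)
  then show ?thesis
    using dominates_upto_trans[OF dominates_upto_F[where A = "{..<R}" and \<delta> = "\<lambda>_. ?\<delta>"
        and \<mu> = "\<lambda>j. uconv.F (\<lambda>(x, k). particle p \<kappa> x) (K j)"] poisson_cells_dominate] cell by simp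
qed

end

section \<open>Infinite product measures\<close>

text \<open>Bridge from the infinite product to finite ones: resetting the coordinates outside
  \<open>Q\<close> to \<open>d\<close> leaves countably many values, so measurability and law can be
  checked on singletons.\<close>

lemma Pi_pmf_eq_distr_PiM:
  fixes p :: "'i \<Rightarrow> 'a :: countable pmf"
  assumes Q: "finite Q"
  shows "(\<lambda>x i. if i \<in> Q then x i else d) \<in> (PiM UNIV (\<lambda>i. measure_pmf (p i))) \<rightarrow>\<^sub>M count_space UNIV"
      (is "?h \<in> ?P \<rightarrow>\<^sub>M _")
    and "distr (PiM UNIV (\<lambda>i. measure_pmf (p i))) (count_space UNIV) (\<lambda>x i. if i \<in> Q then x i else d) =
      measure_pmf (Pi_pmf Q d p)"
proof -
  interpret product_prob_space "\<lambda>i. measure_pmf (p i)" UNIV by unfold_locales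
  define A :: "('i \<Rightarrow> 'a) set" where "A = PiE_dflt Q d (\<lambda>_. UNIV)"
  have A: "countable A"
    unfolding A_def dflt_image_PiE[symmetric] using Q by (intro countable_image countable_PiE) auto
  have hA: "?h x \<in> A" for x by (auto simp: A_def PiE_dflt_def)
  have vimage: "?h -` {a} = {x \<in> space ?P. \<forall>i\<in>Q. x i \<in> {a i}}" if "a \<in> A" for a
    using that by (auto simp: A_def PiE_dflt_def space_PiM fun_eq_iff)
  show h: "?h \<in> ?P \<rightarrow>\<^sub>M count_space UNIV"
  proof (rule measurableI)
    fix X :: "('i \<Rightarrow> 'a) set"
    have "?h -` X \<inter> space ?P = (\<Union>a\<in>X \<inter> A. ?h -` {a})"
      using hA by (auto simp: space_PiM)
    also have "\<dots> \<in> sets ?P"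
    proof (rule sets.countable_UN'')
      show "countable (X \<inter> A)" using A by simp
    next
      fix a assume "a \<in> X \<inter> A"
      then show "?h -` {a} \<in> sets ?P"
        using Q by (subst vimage) (auto intro!: sets.sets_Collect_finite_All)
    qed
    finally show "?h -` X \<inter> space ?P \<in> sets ?P" .
  qed simp
  show "distr ?P (count_space UNIV) ?h = measure_pmf (Pi_pmf Q d p)"
  proof (rule measure_eqI_countable_AE[where \<Omega> = A])
    show "AE x in distr ?P (count_space UNIV) ?h. x \<in> A"
      using hA by (subst AE_distr_iff[OF h]) auto
    show "AE x in measure_pmf (Pi_pmf Q d p). x \<in> A"
      using set_Pi_pmf_subset[OF Q, of d p] by (auto simp: AE_measure_pmf_iff A_def PiE_dflt_def)
  next
    fix a assume a: "a \<in> A"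
    have "emeasure (distr ?P (count_space UNIV) ?h) {a} = emeasure ?P {x \<in> space ?P. \<forall>i\<in>Q. x i \<in> {a i}}"
      using h vimage[OF a] by (subst emeasure_distr) (auto simp: space_PiM)
    also have "\<dots> = (\<Prod>i\<in>Q. emeasure (measure_pmf (p i)) {a i})"
      using Q by (intro emeasure_PiM_Collect) auto
    also have "\<dots> = ennreal (pmf (Pi_pmf Q d p) a)"
      using a Q by (simp add: pmf_Pi A_def PiE_dflt_def emeasure_pmf_single prod_ennreal)
    finally show "emeasure (distr ?P (count_space UNIV) ?h) {a} = emeasure (measure_pmf (Pi_pmf Q d p)) {a}"
      by (simp add: emeasure_pmf_single)
  qed (use A in auto)
qed

lemma
  fixes p :: "'i \<Rightarrow> 'a :: countable pmf" and f :: "('i \<Rightarrow> 'a) \<Rightarrow> real"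
  assumes Q: "finite Q" and dep: "\<And>x y. (\<And>i. i \<in> Q \<Longrightarrow> x i = y i) \<Longrightarrow> f x = f y"
  shows borel_measurable_PiM_finite_dep: "f \<in> borel_measurable (PiM UNIV (\<lambda>i. measure_pmf (p i)))"
    and integral_PiM_finite_dep:
      "(\<integral>x. f x \<partial>PiM UNIV (\<lambda>i. measure_pmf (p i))) = measure_pmf.expectation (Pi_pmf Q d p) f"
proof -
  let ?h = "\<lambda>x i. if i \<in> Q then x i else d"
  note h = Pi_pmf_eq_distr_PiM[OF Q, where p = p and d = d]
  have f: "f = (\<lambda>x. f (?h x))" by (intro ext dep) simp
  show "f \<in> borel_measurable (PiM UNIV (\<lambda>i. measure_pmf (p i)))"
    by (subst f) (rule measurable_compose[OF h(1)], simp)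
  have "measure_pmf.expectation (Pi_pmf Q d p) f = (\<integral>x. f (?h x) \<partial>PiM UNIV (\<lambda>i. measure_pmf (p i)))"
    unfolding h(2)[symmetric] by (rule integral_distr[OF h(1)]) simp
  then show "(\<integral>x. f x \<partial>PiM UNIV (\<lambda>i. measure_pmf (p i))) = measure_pmf.expectation (Pi_pmf Q d p) f"
    using f by simp
qed

lemma (in prob_space) integrable_unit:
  fixes f :: "'a \<Rightarrow> real"
  assumes "f \<in> borel_measurable M" "\<And>x. f x \<in> {0..1}"
  shows "integrable M f"
  using assms by (intro integrable_const_bound[where B = 1]) auto

text \<open>For non-measurable \<open>f\<close> the Bochner integral is 0, so the bound holds there
  too; iterated integrals can then be bounded without measurability arguments.\<close>

lemma (in prob_space) integral_unit:
  fixes f :: "'a \<Rightarrow> real"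
  assumes "\<And>x. f x \<in> {0..1}"
  shows "(\<integral>x. f x \<partial>M) \<in> {0..1}"
proof (cases "f \<in> borel_measurable M")
  case True
  then have "(\<integral>x. f x \<partial>M) \<le> (\<integral>x. 1 \<partial>M)"
    using assms by (intro integral_mono integrable_unit) auto
  then show ?thesis using assms by (simp add: prob_space integral_nonneg_AE)
next
  case False
  then have "\<not> integrable M f" by blast
  then show ?thesis by (simp add: not_integrable_integral_eq)
qed

context product_prob_space
begin

text \<open>Splicing two independent samples along an arbitrary coordinate set \<open>A\<close>
  gives a sample again: on a cylinder over \<open>J\<close> the product splits into
  \<open>J \<inter> A\<close> and \<open>J - A\<close>.\<close>

lemma distr_merge_PiM_UNIV:
  assumes I: "I = UNIV"
  shows "distr (PiM I M \<Otimes>\<^sub>M PiM I M) (PiM I M) (\<lambda>(x, y) i. if i \<in> A then x i else y i) = PiM I M"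
proof (rule PiM_eq)
  let ?P = "PiM I M"
  let ?m = "\<lambda>(x, y) i. if i \<in> A then x i else y i"
  have m: "?m \<in> ?P \<Otimes>\<^sub>M ?P \<rightarrow>\<^sub>M ?P"
    unfolding I case_prod_unfold by (rule measurable_PiM_single') (auto simp: space_pair_measure space_PiM PiE_iff)
  interpret P: prob_space ?P by (rule P.prob_space_axioms)
  interpret PP: pair_prob_space ?P ?P ..
  fix J F assume J: "finite J" "J \<subseteq> I" and F: "\<And>j. j \<in> J \<Longrightarrow> F j \<in> sets (M j)"
  have emb: "prod_emb I M J (\<Pi>\<^sub>E j\<in>J. F j) = {x \<in> space ?P. \<forall>j\<in>J. x j \<in> F j}"
    using J(2) by (auto simp: prod_emb_def space_PiM Pi_iff)
  have mspace: "?m (x, y) \<in> space ?P" if "x \<in> space ?P" "y \<in> space ?P" for x y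
    using that by (auto simp: space_PiM I PiE_iff)
  have "emeasure (distr (?P \<Otimes>\<^sub>M ?P) ?P ?m) (prod_emb I M J (\<Pi>\<^sub>E j\<in>J. F j)) =
      emeasure (?P \<Otimes>\<^sub>M ?P) (?m -` {x \<in> space ?P. \<forall>j\<in>J. x j \<in> F j} \<inter> space (?P \<Otimes>\<^sub>M ?P))"
    unfolding emb[symmetric] using J F by (intro emeasure_distr m) auto
  also have "?m -` {x \<in> space ?P. \<forall>j\<in>J. x j \<in> F j} \<inter> space (?P \<Otimes>\<^sub>M ?P) =
      {x \<in> space ?P. \<forall>j\<in>J \<inter> A. x j \<in> F j} \<times> {x \<in> space ?P. \<forall>j\<in>J - A. x j \<in> F j}"
    using mspace by (auto simp: space_pair_measure split: if_splits)
  also have "emeasure (?P \<Otimes>\<^sub>M ?P) \<dots> =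
      emeasure ?P {x \<in> space ?P. \<forall>j\<in>J \<inter> A. x j \<in> F j} * emeasure ?P {x \<in> space ?P. \<forall>j\<in>J - A. x j \<in> F j}"
    using J F by (intro P.emeasure_pair_measure_Times sets.sets_Collect_finite_All)
      (auto intro!: sets_Collect_single' simp: I)
  also have "\<dots> = (\<Prod>j\<in>J \<inter> A. emeasure (M j) (F j)) * (\<Prod>j\<in>J - A. emeasure (M j) (F j))"
    using J F by (subst (1 2) emeasure_PiM_Collect) auto
  also have "\<dots> = (\<Prod>j\<in>J. emeasure (M j) (F j))"
    using J(1) prod.Int_Diff by metis
  finally show "emeasure (distr (?P \<Otimes>\<^sub>M ?P) ?P ?m) (prod_emb I M J (\<Pi>\<^sub>E j\<in>J. F j)) = (\<Prod>j\<in>J. emeasure (M j) (F j))" .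
qed simp

text \<open>On a spliced sample \<open>u\<close> sees only the first copy and \<open>v\<close> only
  the second, so Fubini factorises the integral.\<close>

lemma integral_mult_disjoint_coords:
  fixes u v :: "('i \<Rightarrow> 'a) \<Rightarrow> real"
  assumes I: "I = UNIV"
    and u[measurable]: "u \<in> borel_measurable (PiM I M)" and u1: "\<And>x. u x \<in> {0..1}"
    and v[measurable]: "v \<in> borel_measurable (PiM I M)" and v1: "\<And>x. v x \<in> {0..1}"
    and udep: "\<And>x y. (\<And>i. i \<in> A \<Longrightarrow> x i = y i) \<Longrightarrow> u x = u y"
    and vdep: "\<And>x y. (\<And>i. i \<notin> A \<Longrightarrow> x i = y i) \<Longrightarrow> v x = v y"
  shows "(\<integral>x. u x * v x \<partial>PiM I M) = (\<integral>x. u x \<partial>PiM I M) * (\<integral>x. v x \<partial>PiM I M)"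
proof -
  let ?P = "PiM I M"
  let ?m = "\<lambda>(x, y) i. if i \<in> A then x i else y i"
  interpret PP: pair_prob_space ?P ?P ..
  have m: "?m \<in> ?P \<Otimes>\<^sub>M ?P \<rightarrow>\<^sub>M ?P"
    unfolding I case_prod_unfold by (rule measurable_PiM_single') (auto simp: space_pair_measure space_PiM PiE_iff)
  have "u (?m z) * v (?m z) = u (fst z) * v (snd z)" for z
    using udep[of "?m z" "fst z"] vdep[of "?m z" "snd z"] by (simp add: case_prod_unfold)
  then have "(\<integral>x. u x * v x \<partial>?P) = (\<integral>z. u (fst z) * v (snd z) \<partial>(?P \<Otimes>\<^sub>M ?P))"
    by (subst distr_merge_PiM_UNIV[OF I, symmetric, of A]) (simp add: integral_distr[OF m])
  also have "\<dots> = (\<integral>x. (\<integral>y. u x * v y \<partial>?P) \<partial>?P)"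
  proof -
    have "integrable (?P \<Otimes>\<^sub>M ?P) (\<lambda>z. u (fst z) * v (snd z))"
      using u1 v1 by (intro PP.integrable_unit) (auto intro: mult_le_one)
    from PP.integral_fst'[OF this] show ?thesis by simp
  qed
  also have "\<dots> = (\<integral>x. u x \<partial>?P) * (\<integral>y. v y \<partial>?P)" by simp
  finally show ?thesis .
qed

end

section \<open>Exponential tail bounds for Poisson counts\<close>

lemma poisson_upper_tail:
  assumes m: "0 < m" and t: "0 < t"
  shows "measure_pmf.prob (poisson_pmf m) {M<..} \<le> exp (m * (exp t - 1) - t * real (Suc M))"
proof -
  let ?P = "poisson_pmf m"
  have int: "integrable (measure_pmf ?P) (\<lambda>k. exp t ^ k)"
    by (rule integrable_poisson_pgf) (use m in auto)
  have "measure_pmf.prob ?P {M<..} = measure_pmf.expectation ?P (indicator {M<..})" by simp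
  \<comment> \<open>Markov's inequality for \<open>exp t ^ k\<close>; the event means
    \<open>k \<ge> Suc M\<close>, whence \<open>Suc M\<close> in the exponent.\<close>
  also have "\<dots> \<le> measure_pmf.expectation ?P (\<lambda>k. exp (- t * real (Suc M)) * exp t ^ k)"
  proof (intro integral_mono integrable_mult_right int)
    fix k
    have "1 \<le> exp (- t * real (Suc M)) * exp t ^ k" if "M < k"
    proof -
      have "t * real (Suc M) \<le> t * real k" using that t by (intro mult_left_mono) auto
      then show ?thesis by (simp add: exp_of_nat_mult[symmetric] exp_add[symmetric] mult_ac del: of_nat_Suc)
    qed
    then show "indicator {M<..} k \<le> exp (- t * real (Suc M)) * exp t ^ k" by (auto simp: indicator_def)
  qed (auto intro!: integrable_measure_pmf_unit simp: indicator_def)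
  also have "\<dots> = exp (m * (exp t - 1) - t * real (Suc M))"
    using expectation_poisson_pgf[OF m, of "exp t"] by (simp add: exp_add[symmetric] algebra_simps del: of_nat_Suc)
  finally show ?thesis .
qed

text \<open>The Chernoff weight is a product over the sites of \<open>A\<close>, so its mean
  factorises directly, and the law of the sum never has to be identified.\<close>

lemma poisson_sum_lower_tail:
  fixes A :: "'i set"
  assumes A: "finite A" and m: "0 < m" and t: "0 < t"
  shows "measure (PiM UNIV (\<lambda>_. measure_pmf (poisson_pmf m))) {N. (\<Sum>x\<in>A. N x) < M}
    \<le> exp (t * real M - m * real (card A) * (1 - exp (- t)))"
proof -
  let ?P = "PiM UNIV (\<lambda>_ :: 'i. measure_pmf (poisson_pmf m))"
  interpret product_prob_space "\<lambda>_ :: 'i. measure_pmf (poisson_pmf m)" UNIV by unfold_locales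
  define f where "f N = exp (t * real M) * (\<Prod>x\<in>A. exp (- t) ^ N x)" for N :: "'i \<Rightarrow> nat"
  have f_eq: "f N = exp (t * (real M - real (\<Sum>x\<in>A. N x)))" for N
    using A by (simp add: f_def exp_of_nat_mult[symmetric] exp_sum[symmetric] exp_add[symmetric] sum_distrib_left
        sum_negf algebra_simps)
  have f_dep: "f N = f N'" if "\<And>i. i \<in> A \<Longrightarrow> N i = N' i" for N N'
    using that by (simp add: f_def)
  note f_meas = borel_measurable_PiM_finite_dep[of A f "\<lambda>_. poisson_pmf m", OF A f_dep]
  have ind: "(\<lambda>N. of_bool ((\<Sum>x\<in>A. N x) < M) :: real) \<in> borel_measurable ?P"
    by (intro borel_measurable_PiM_finite_dep[OF A]) (auto intro!: sum.cong arg_cong[of _ _ of_bool])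
  have "0 \<le> f N" "f N \<le> exp (t * real M)" for N
    using t by (simp_all add: f_eq sum_nonneg)
  then have f_int: "integrable ?P f"
    using f_meas by (intro P.integrable_const_bound[where B = "exp (t * real M)"]) auto
  have "measure ?P {N. (\<Sum>x\<in>A. N x) < M} = (\<integral>N. of_bool ((\<Sum>x\<in>A. N x) < M) \<partial>?P)"
  proof -
    have "(\<lambda>N. of_bool ((\<Sum>x\<in>A. N x) < M) :: real) = indicator {N. (\<Sum>x\<in>A. N x) < M}"
      by (auto simp: indicator_def)
    then show ?thesis by (simp add: space_PiM)
  qed
  also have "\<dots> \<le> (\<integral>N. f N \<partial>?P)"
  proof (intro integral_mono f_int P.integrable_unit ind)
    fix N :: "'i \<Rightarrow> nat"
    show "of_bool ((\<Sum>x\<in>A. N x) < M) \<le> f N"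
      using t unfolding f_eq by (auto simp: of_nat_less_iff[symmetric] simp del: of_nat_sum of_nat_less_iff)
  qed auto
  also have "\<dots> = exp (t * real M) * (\<Prod>x\<in>A. measure_pmf.expectation (poisson_pmf m) (\<lambda>k. exp (- t) ^ k))"
  proof -
    have "(\<integral>N. f N \<partial>?P) = measure_pmf.expectation (Pi_pmf A 0 (\<lambda>_. poisson_pmf m)) f"
      by (rule integral_PiM_finite_dep[OF A f_dep])
    also have "\<dots> = exp (t * real M) *
        measure_pmf.expectation (Pi_pmf A 0 (\<lambda>_. poisson_pmf m)) (\<lambda>N. \<Prod>x\<in>A. exp (- t) ^ N x)"
      by (simp add: f_def[abs_def])
    finally show ?thesis
      using A integrable_poisson_pgf[OF m, of "exp (- t)"] by (subst (asm) expectation_prod_Pi_pmf) auto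
  qed
  also have "\<dots> = exp (t * real M - m * real (card A) * (1 - exp (- t)))"
    using expectation_poisson_pgf[OF m, of "exp (- t)"]
    by (simp add: exp_of_nat_mult[symmetric] exp_add[symmetric] algebra_simps)
  finally show ?thesis .
qed

section \<open>Restricting random variables to past and future\<close>

abbreviation counts_measure :: "real \<Rightarrow> (int \<Rightarrow> nat) measure" where
  "counts_measure \<rho> \<equiv> PiM UNIV (\<lambda>_. measure_pmf (poisson_pmf \<rho>))"

abbreviation steps_measure :: "real \<Rightarrow> (int \<times> nat \<times> int \<Rightarrow> int) measure" where
  "steps_measure q \<equiv> PiM UNIV (\<lambda>_. measure_pmf (step_pmf q))"

abbreviation unifs_measure :: "unifs measure" where
  "unifs_measure \<equiv> PiM UNIV (\<lambda>_. uniform_measure lborel {0..1})"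

lemma prob_space_uniform01: "prob_space (uniform_measure lborel {0..1::real})"
  by (rule prob_space_uniform_measure) auto

lemma prob_space_unifs: "prob_space unifs_measure"
  by (rule prob_space_PiM) (rule prob_space_uniform01)

lemma prob_space_steps: "prob_space (steps_measure q)"
  by (rule prob_space_PiM) (rule measure_pmf.prob_space_axioms)

lemma prob_space_counts: "prob_space (counts_measure \<rho>)"
  by (rule prob_space_PiM) (rule measure_pmf.prob_space_axioms)

section \<open>Samples clipped to legal values and masked outside given coordinates\<close>

definition clip_step :: "int \<Rightarrow> int" where
  "clip_step s = (if s \<in> {-1, 0, 1} then s else 0)"

definition clip_unif :: "real \<Rightarrow> real" where
  "clip_unif u = max 0 (min 1 u)"

definition mask_steps :: "(int \<times> nat \<times> int) set \<Rightarrow> (int \<times> nat \<times> int \<Rightarrow> int) \<Rightarrow> int \<times> nat \<times> int \<Rightarrow> int" where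
  "mask_steps A S i = (if i \<in> A then clip_step (S i) else 0)"

definition mask_unifs :: "(int \<times> int) set \<Rightarrow> unifs \<Rightarrow> unifs" where
  "mask_unifs D U y = (if y \<in> D then clip_unif (U y) else 0)"

text \<open>The hypotheses on \<open>f\<close> hold on \<open>Omega\<close> only, while sample
  points can have illegal steps or uniforms on a null set. Clipping sends every sample into
  \<open>Omega\<close>, and masking makes the dependence on the coordinates in \<open>A\<close> and
  \<open>D\<close> literal. Bounds and independence then hold everywhere, and almost sure arguments
  are confined to the comparison with \<open>f\<close>.\<close>

definition masked where
  "masked A D f N S U = f (outcome (N, mask_steps A S, mask_unifs D U))"

lemma mask_steps_bounds: "\<bar>mask_steps A S i\<bar> \<le> 1"
  by (simp add: mask_steps_def clip_step_def)

lemma walk_succ: "walk S x k (t + 1) = walk S x k t + S (x, k, t)"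
proof (cases "0 \<le> t")
  case True
  then have "{0..<t + 1} = insert t {0..<t}" by auto
  then show ?thesis using True by (simp add: walk_def)
next
  case False
  then have "{t..<0} = insert t {t + 1..<0}" by auto
  then show ?thesis using False by (auto simp: walk_def)
qed

lemma walk_in_Wpaths: "(\<And>i. \<bar>S i\<bar> \<le> 1) \<Longrightarrow> walk S x k \<in> Wpaths"
  by (simp add: Wpaths_def walk_succ)

lemma masked_in_Omega: "outcome (N, mask_steps A S, mask_unifs D U) \<in> Omega"
  by (auto simp: outcome_def conf_of_def Omega_def mask_unifs_def clip_unif_def
      intro!: walk_in_Wpaths mask_steps_bounds)

lemma masked_unit: "(\<And>z. z \<in> Omega \<Longrightarrow> f z \<in> {0..1}) \<Longrightarrow> masked A D f N S U \<in> {0..1::real}"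
  unfolding masked_def using masked_in_Omega by blast

lemma masked_dep:
  assumes "\<And>i. i \<in> A \<Longrightarrow> S i = S' i" "\<And>y. y \<in> D \<Longrightarrow> U y = U' y"
  shows "masked A D f N S U = masked A D f N S' U'"
proof -
  have "mask_steps A S = mask_steps A S'" "mask_unifs D U = mask_unifs D U'"
    using assms by (auto simp: mask_steps_def mask_unifs_def)
  then show ?thesis by (simp add: masked_def)
qed

text \<open>Measurability of \<open>f\<close> is given only after composition with
  \<open>outcome\<close>; masking is a measurable map of the sample space to itself that comes
  before \<open>outcome\<close>.\<close>

lemma borel_measurable_masked:
  assumes "random_var q f" "0 < \<rho>"
  shows "(\<lambda>r. masked A D f (fst r) (fst (snd r)) (snd (snd r))) \<in> borel_measurable (base_space q \<rho>)"
proof -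
  let ?m = "\<lambda>r. (fst r, mask_steps A (fst (snd r)), mask_unifs D (snd (snd r)))"
  have f: "(\<lambda>r. f (outcome r)) \<in> borel_measurable (base_space q \<rho>)"
    using assms by (simp add: random_var_def)
  have S: "mask_steps A \<in> steps_measure q \<rightarrow>\<^sub>M steps_measure q"
    unfolding mask_steps_def[abs_def]
  proof (rule measurable_PiM_single')
    fix i :: "int \<times> nat \<times> int"
    have "(\<lambda>S. S i) \<in> steps_measure q \<rightarrow>\<^sub>M measure_pmf (step_pmf q)"
      by (rule measurable_component_singleton) simp
    from measurable_compose[OF this, of "\<lambda>s. if i \<in> A then clip_step s else 0"]
    show "(\<lambda>S. if i \<in> A then clip_step (S i) else 0) \<in> steps_measure q \<rightarrow>\<^sub>M measure_pmf (step_pmf q)"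
      by simp
  qed (simp add: space_PiM)
  have U: "mask_unifs D \<in> unifs_measure \<rightarrow>\<^sub>M unifs_measure"
    unfolding mask_unifs_def[abs_def] clip_unif_def
  proof (rule measurable_PiM_single')
    fix y :: "int \<times> int"
    have [measurable]: "(\<lambda>U. U y) \<in> unifs_measure \<rightarrow>\<^sub>M borel"
      using measurable_component_singleton[of y UNIV "\<lambda>_. uniform_measure lborel {0..1::real}"]
      by (simp cong: measurable_cong_sets)
    have "(\<lambda>U. if y \<in> D then max 0 (min 1 (U y)) else 0) \<in> unifs_measure \<rightarrow>\<^sub>M (borel :: real measure)"
      by measurable
    then show "(\<lambda>U. if y \<in> D then max 0 (min 1 (U y)) else 0) \<in> unifs_measure \<rightarrow>\<^sub>M uniform_measure lborel {0..1}"
      by (simp cong: measurable_cong_sets)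
  qed (simp add: space_PiM)
  have "?m \<in> base_space q \<rho> \<rightarrow>\<^sub>M base_space q \<rho>"
    unfolding base_space_def
    by (intro measurable_Pair measurable_compose[OF _ S] measurable_compose[OF _ U]
        measurable_fst measurable_snd measurable_compose[OF measurable_snd measurable_fst]
        measurable_compose[OF measurable_snd measurable_snd])
  from measurable_compose[OF this f] show ?thesis by (simp add: masked_def[abs_def])
qed

lemma AE_steps: 
  assumes "0 < q" "q < 1"
  shows "AE S in steps_measure q. \<forall>i. S i \<in> {-1, 0, 1}"
proof -
  have "AE S in steps_measure q. S i \<in> {-1, 0, 1}" for i
    by (rule AE_PiM_component) (use set_step_pmf[OF assms] in \<open>auto simp: AE_measure_pmf_iff intro: measure_pmf.prob_space_axioms\<close>)
  then show ?thesis by (subst AE_all_countable) auto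
qed

lemma AE_unifs: "AE U in unifs_measure. \<forall>y. U y \<in> {0..1}"
proof -
  have "AE U in unifs_measure. U y \<in> {0..1}" for y
  proof (rule AE_PiM_component)
    show "AE u in uniform_measure lborel {0..1::real}. u \<in> {0..1}"
      by (rule AE_uniform_measureI) auto
  qed (auto intro: prob_space_uniform01)
  then show ?thesis by (subst AE_all_countable) auto
qed

lemma traj_conf_of: "(y, t) \<in> traj (conf_of (N, S, U)) \<longleftrightarrow> (\<exists>x k. k < N x \<and> walk S x k t = y)"
  by (auto simp: traj_def conf_of_def)

text \<open>The hypothesis on \<open>A\<close> says that the steps indexed by \<open>A\<close> determine every walk at the times
  occurring in \<open>D\<close>.\<close>

lemma masked_eq:
  assumes supp: "has_support f D"
    and A: "\<And>x k y t m. (y, t) \<in> D \<Longrightarrow> 0 \<le> m \<and> m < t \<or> t \<le> m \<and> m < 0 \<Longrightarrow> (x, k, m) \<in> A"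
    and S: "\<And>i. S i \<in> {-1, 0, 1}" and U: "\<And>y. U y \<in> {0..1}"
  shows "f (outcome (N, S, U)) = masked A D f N S U"
proof -
  have clip: "clip_step (S i) = S i" for i using S[of i] unfolding clip_step_def by (rule if_P)
  have mask: "mask_steps A S (x, k, m) = S (x, k, m)"
    if "(y, t) \<in> D" "0 \<le> m \<and> m < t \<or> t \<le> m \<and> m < 0" for x k y t m
    using A[OF that] by (simp add: mask_steps_def clip)
  have walk_eq: "walk (mask_steps A S) x k t = walk S x k t" if "(y, t) \<in> D" for x k y t
    unfolding walk_def by (auto intro!: sum.cong mask[OF that])
  have "traj (conf_of (N, S, U)) \<inter> D = traj (conf_of (N, mask_steps A S, mask_unifs D U)) \<inter> D"
  proof -
    have "(x, t) \<in> traj (conf_of (N, S, U)) \<longleftrightarrow> (x, t) \<in> traj (conf_of (N, mask_steps A S, mask_unifs D U))"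
      if "(x, t) \<in> D" for x t
      by (simp add: traj_conf_of walk_eq[OF that])
    then show ?thesis by auto
  qed
  moreover have "\<forall>y\<in>D. U y = mask_unifs D U y"
    using U by (simp add: mask_unifs_def clip_unif_def)
  moreover have S1: "\<bar>S i\<bar> \<le> 1" for i using mask_steps_bounds[of "{i}" S i] by (simp add: mask_steps_def clip)
  have "outcome (N, S, U) \<in> Omega"
    unfolding outcome_def conf_of_def Omega_def using U walk_in_Wpaths[of S, OF S1] by auto
  ultimately show ?thesis
    using supp masked_in_Omega[of N A S D U] unfolding has_support_def masked_def outcome_def snd_conv
    by blast
qed

section \<open>Almost sure legality of samples, and Fubini on the sample space\<close>

lemma (in sigma_finite_measure) AE_pair_snd:
  assumes "AE y in M. P y"
  shows "AE z in L \<Otimes>\<^sub>M M. P (snd z)"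
proof -
  obtain E where E: "E \<in> null_sets M" "{y \<in> space M. \<not> P y} \<subseteq> E"
    using assms by (auto simp: eventually_ae_filter)
  have null: "space L \<times> E \<in> null_sets (L \<Otimes>\<^sub>M M)"
    using E(1) by (auto simp: null_sets_def emeasure_pair_measure_Times)
  show ?thesis
    by (rule AE_I'[OF null]) (use E(2) in \<open>auto simp: space_pair_measure\<close>)
qed

lemma (in sigma_finite_measure) AE_pair_fst:
  assumes "AE x in L. P x"
  shows "AE z in L \<Otimes>\<^sub>M M. P (fst z)"
proof -
  obtain E where E: "E \<in> null_sets L" "{x \<in> space L. \<not> P x} \<subseteq> E"
    using assms by (auto simp: eventually_ae_filter)
  have null: "E \<times> space M \<in> null_sets (L \<Otimes>\<^sub>M M)"
    using E(1) by (auto simp: null_sets_def emeasure_pair_measure_Times)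
  show ?thesis
    by (rule AE_I'[OF null]) (use E(2) in \<open>auto simp: space_pair_measure\<close>)
qed

context
  fixes q \<rho> :: real
  assumes q: "0 < q" "q < 1" and \<rho>: "0 < \<rho>"
begin

interpretation N: prob_space "counts_measure \<rho>" by (rule prob_space_counts)
interpretation S: prob_space "steps_measure q" by (rule prob_space_steps)
interpretation U: prob_space unifs_measure by (rule prob_space_unifs)
interpretation SU: pair_prob_space "steps_measure q" unifs_measure ..
interpretation NU: pair_prob_space "counts_measure \<rho>" unifs_measure ..
interpretation NSU: pair_prob_space "counts_measure \<rho>" "steps_measure q \<Otimes>\<^sub>M unifs_measure" ..

lemma AE_base_space:
  "AE r in base_space q \<rho>. (\<forall>i. fst (snd r) i \<in> {-1, 0, 1}) \<and> (\<forall>y. snd (snd r) y \<in> {0..1})"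
proof -
  have "AE z in steps_measure q \<Otimes>\<^sub>M unifs_measure. \<forall>i. fst z i \<in> {-1, 0, 1}"
    using U.AE_pair_fst[OF AE_steps[OF q]] .
  moreover have "AE z in steps_measure q \<Otimes>\<^sub>M unifs_measure. \<forall>y. snd z y \<in> {0..1}"
    using U.AE_pair_snd[OF AE_unifs] .
  ultimately have "AE z in steps_measure q \<Otimes>\<^sub>M unifs_measure.
      (\<forall>i. fst z i \<in> {-1, 0, 1}) \<and> (\<forall>y. snd z y \<in> {0..1})"
    by (rule AE_conjI)
  then show ?thesis
    unfolding base_space_def by (rule SU.AE_pair_snd)
qed

text \<open>Collects the orders of integration used later: counts outermost in order to condition on
  them, uniforms outermost because the future is compared for fixed uniforms.\<close>

lemma integral_base_space:
  fixes G :: "_ \<Rightarrow> _ \<Rightarrow> _ \<Rightarrow> real"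
  assumes G: "(\<lambda>r. G (fst r) (fst (snd r)) (snd (snd r))) \<in> borel_measurable (base_space q \<rho>)"
    and unit: "\<And>N S U. G N S U \<in> {0..1}"
  shows "(\<integral>r. G (fst r) (fst (snd r)) (snd (snd r)) \<partial>base_space q \<rho>) =
      (\<integral>N. \<integral>S. \<integral>U. G N S U \<partial>unifs_measure \<partial>steps_measure q \<partial>counts_measure \<rho>)"
    and "(\<integral>S. \<integral>U. G N S U \<partial>unifs_measure \<partial>steps_measure q) =
      (\<integral>U. \<integral>S. G N S U \<partial>steps_measure q \<partial>unifs_measure)"
    and "(\<lambda>N. \<integral>S. \<integral>U. G N S U \<partial>unifs_measure \<partial>steps_measure q) \<in> borel_measurable (counts_measure \<rho>)"
    and "(\<lambda>S. \<integral>U. G N S U \<partial>unifs_measure) \<in> borel_measurable (steps_measure q)"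
    and "(\<lambda>U. G N S U) \<in> borel_measurable unifs_measure"
    and "(\<lambda>U. \<integral>S. G N S U \<partial>steps_measure q) \<in> borel_measurable unifs_measure"
    and "(\<lambda>U. \<integral>N. \<integral>S. G N S U \<partial>steps_measure q \<partial>counts_measure \<rho>) \<in> borel_measurable unifs_measure"
    and "(\<integral>N. \<integral>S. \<integral>U. G N S U \<partial>unifs_measure \<partial>steps_measure q \<partial>counts_measure \<rho>) =
      (\<integral>U. \<integral>N. \<integral>S. G N S U \<partial>steps_measure q \<partial>counts_measure \<rho> \<partial>unifs_measure)"
proof -
  have G': "(\<lambda>(N, S, U). G N S U) \<in> borel_measurable
      (counts_measure \<rho> \<Otimes>\<^sub>M (steps_measure q \<Otimes>\<^sub>M unifs_measure))"
    using G by (simp add: base_space_def case_prod_unfold)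
  have sp: "N \<in> space (counts_measure \<rho>)" "S \<in> space (steps_measure q)" "U \<in> space unifs_measure" for N S U
    by (auto simp: space_PiM)
  have NU: "(\<lambda>(N, U). \<integral>S. G N S U \<partial>steps_measure q) \<in> borel_measurable (counts_measure \<rho> \<Otimes>\<^sub>M unifs_measure)"
  proof -
    have "(\<lambda>z. (fst (fst z), (snd z, snd (fst z)))) \<in> (counts_measure \<rho> \<Otimes>\<^sub>M unifs_measure) \<Otimes>\<^sub>M steps_measure q
        \<rightarrow>\<^sub>M counts_measure \<rho> \<Otimes>\<^sub>M (steps_measure q \<Otimes>\<^sub>M unifs_measure)"
      by (intro measurable_Pair measurable_snd measurable_compose[OF measurable_fst measurable_fst]
          measurable_compose[OF measurable_fst measurable_snd])
    from measurable_compose[OF this G']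
    have "(\<lambda>(z, S). G (fst z) S (snd z)) \<in> borel_measurable ((counts_measure \<rho> \<Otimes>\<^sub>M unifs_measure) \<Otimes>\<^sub>M steps_measure q)"
      by (simp add: case_prod_unfold)
    from S.borel_measurable_lebesgue_integral[OF this] show ?thesis
      by (simp add: case_prod_unfold)
  qed
  have NS: "(\<lambda>(N, S). \<integral>U. G N S U \<partial>unifs_measure) \<in> borel_measurable (counts_measure \<rho> \<Otimes>\<^sub>M steps_measure q)"
  proof -
    have "(\<lambda>z. (fst (fst z), (snd (fst z), snd z))) \<in> (counts_measure \<rho> \<Otimes>\<^sub>M steps_measure q) \<Otimes>\<^sub>M unifs_measure
        \<rightarrow>\<^sub>M counts_measure \<rho> \<Otimes>\<^sub>M (steps_measure q \<Otimes>\<^sub>M unifs_measure)"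
      by (intro measurable_Pair measurable_snd measurable_compose[OF measurable_fst measurable_fst]
          measurable_compose[OF measurable_fst measurable_snd])
    from measurable_compose[OF this G']
    have "(\<lambda>(z, U). G (fst z) (snd z) U) \<in> borel_measurable ((counts_measure \<rho> \<Otimes>\<^sub>M steps_measure q) \<Otimes>\<^sub>M unifs_measure)"
      by (simp add: case_prod_unfold)
    from U.borel_measurable_lebesgue_integral[OF this] show ?thesis
      by (simp add: case_prod_unfold)
  qed
  have GN: "(\<lambda>z. G N (fst z) (snd z)) \<in> borel_measurable (steps_measure q \<Otimes>\<^sub>M unifs_measure)" for N
    using measurable_Pair2[OF G' sp(1), of N] by (simp add: case_prod_unfold)
  show SU: "(\<integral>S. \<integral>U. G N S U \<partial>unifs_measure \<partial>steps_measure q) =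
      (\<integral>U. \<integral>S. G N S U \<partial>steps_measure q \<partial>unifs_measure)" for N
    using GN[of N] unit by (intro SU.Fubini_integral[symmetric] SU.integrable_unit) (auto simp: case_prod_unfold)
  show "(\<lambda>N. \<integral>S. \<integral>U. G N S U \<partial>unifs_measure \<partial>steps_measure q) \<in> borel_measurable (counts_measure \<rho>)"
    by (rule S.borel_measurable_lebesgue_integral[OF NS])
  show "(\<lambda>S. \<integral>U. G N S U \<partial>unifs_measure) \<in> borel_measurable (steps_measure q)"
    using measurable_Pair2[OF NS sp(1), of N] by simp
  show "(\<lambda>U. G N S U) \<in> borel_measurable unifs_measure"
    using measurable_Pair2[OF GN sp(2), of N S] by simp
  show "(\<lambda>U. \<integral>S. G N S U \<partial>steps_measure q) \<in> borel_measurable unifs_measure"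
    using measurable_Pair2[OF NU sp(1), of N] by simp
  show "(\<lambda>U. \<integral>N. \<integral>S. G N S U \<partial>steps_measure q \<partial>counts_measure \<rho>) \<in> borel_measurable unifs_measure"
    using measurable_pair_swap[OF NU] by (intro N.borel_measurable_lebesgue_integral) (simp add: case_prod_unfold)
  have "(\<integral>r. G (fst r) (fst (snd r)) (snd (snd r)) \<partial>base_space q \<rho>) =
      (\<integral>N. \<integral>z. G N (fst z) (snd z) \<partial>(steps_measure q \<Otimes>\<^sub>M unifs_measure) \<partial>counts_measure \<rho>)"
    unfolding base_space_def
    using G unit by (subst NSU.integral_fst'[symmetric]) (auto simp: base_space_def intro!: NSU.integrable_unit)
  also have "\<dots> = (\<integral>N. \<integral>S. \<integral>U. G N S U \<partial>unifs_measure \<partial>steps_measure q \<partial>counts_measure \<rho>)"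
    using GN unit by (intro Bochner_Integration.integral_cong refl)
      (subst SU.integral_fst'[symmetric], auto intro!: SU.integrable_unit)
  finally show "(\<integral>r. G (fst r) (fst (snd r)) (snd (snd r)) \<partial>base_space q \<rho>) =
      (\<integral>N. \<integral>S. \<integral>U. G N S U \<partial>unifs_measure \<partial>steps_measure q \<partial>counts_measure \<rho>)" .
  have "(\<integral>N. \<integral>S. \<integral>U. G N S U \<partial>unifs_measure \<partial>steps_measure q \<partial>counts_measure \<rho>) =
      (\<integral>N. \<integral>U. \<integral>S. G N S U \<partial>steps_measure q \<partial>unifs_measure \<partial>counts_measure \<rho>)"
    by (simp only: SU)
  also have "\<dots> = (\<integral>U. \<integral>N. \<integral>S. G N S U \<partial>steps_measure q \<partial>counts_measure \<rho> \<partial>unifs_measure)"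
    using NU S.integral_unit[OF unit] by (intro NU.Fubini_integral[symmetric] NU.integrable_unit) (auto simp: case_prod_unfold)
  finally show "(\<integral>N. \<integral>S. \<integral>U. G N S U \<partial>unifs_measure \<partial>steps_measure q \<partial>counts_measure \<rho>) =
      (\<integral>U. \<integral>N. \<integral>S. G N S U \<partial>steps_measure q \<partial>counts_measure \<rho> \<partial>unifs_measure)" .
qed

lemma Exp_eq_masked:
  assumes f: "random_var q f" "\<And>z. z \<in> Omega \<Longrightarrow> f z \<in> {0..1}" "has_support f D"
    and A: "\<And>x k y t m. (y, t) \<in> D \<Longrightarrow> 0 \<le> m \<and> m < t \<or> t \<le> m \<and> m < 0 \<Longrightarrow> (x, k, m) \<in> A"
  shows "Exp q \<rho> f =
    (\<integral>N. \<integral>S. \<integral>U. masked A D f N S U \<partial>unifs_measure \<partial>steps_measure q \<partial>counts_measure \<rho>)"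
proof -
  have "Exp q \<rho> f = (\<integral>r. masked A D f (fst r) (fst (snd r)) (snd (snd r)) \<partial>base_space q \<rho>)"
    unfolding Exp_def
  proof (rule integral_cong_AE)
    show "(\<lambda>r. f (outcome r)) \<in> borel_measurable (base_space q \<rho>)"
      using f(1) \<rho> by (simp add: random_var_def)
    show "AE r in base_space q \<rho>. f (outcome r) = masked A D f (fst r) (fst (snd r)) (snd (snd r))"
      using AE_base_space by eventually_elim (use masked_eq[OF f(3) A] in force)
  qed (rule borel_measurable_masked[OF f(1) \<rho>])
  also have "\<dots> = (\<integral>N. \<integral>S. \<integral>U. masked A D f N S U \<partial>unifs_measure \<partial>steps_measure q \<partial>counts_measure \<rho>)"
    using borel_measurable_masked[OF f(1) \<rho>] masked_unit[OF f(2)] by (rule integral_base_space(1))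
  finally show ?thesis .
qed

text \<open>For fixed counts the two factors read disjoint sets of uniforms and of steps, so first
  the uniforms and then the steps factorise; the counts are the only randomness they share.\<close>

lemma Exp_mult_eq:
  assumes f1: "random_var q f1" "\<And>z. z \<in> Omega \<Longrightarrow> f1 z \<in> {0..1}" "has_support f1 D1"
    and A1: "\<And>x k y t m. (y, t) \<in> D1 \<Longrightarrow> 0 \<le> m \<and> m < t \<or> t \<le> m \<and> m < 0 \<Longrightarrow> (x, k, m) \<in> A1"
    and f2: "random_var q f2" "\<And>z. z \<in> Omega \<Longrightarrow> f2 z \<in> {0..1}" "has_support f2 D2"
    and A2: "\<And>x k y t m. (y, t) \<in> D2 \<Longrightarrow> 0 \<le> m \<and> m < t \<or> t \<le> m \<and> m < 0 \<Longrightarrow> (x, k, m) \<in> A2"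
    and disj: "A1 \<inter> A2 = {}" "D1 \<inter> D2 = {}"
  shows "Exp q \<rho> (\<lambda>z. f1 z * f2 z) =
    (\<integral>N. (\<integral>S. \<integral>U. masked A1 D1 f1 N S U \<partial>unifs_measure \<partial>steps_measure q) *
         (\<integral>S. \<integral>U. masked A2 D2 f2 N S U \<partial>unifs_measure \<partial>steps_measure q) \<partial>counts_measure \<rho>)"
proof -
  interpret U: product_prob_space "\<lambda>_. uniform_measure lborel {0..1::real}" "UNIV :: (int \<times> int) set"
    by (rule product_prob_spaceI) (rule prob_space_uniform01)
  interpret S: product_prob_space "\<lambda>_. measure_pmf (step_pmf q)" "UNIV :: (int \<times> nat \<times> int) set"
    by (rule product_prob_spaceI) (rule measure_pmf.prob_space_axioms)
  let ?g1 = "masked A1 D1 f1" and ?g2 = "masked A2 D2 f2"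
  have m1: "(\<lambda>r. ?g1 (fst r) (fst (snd r)) (snd (snd r))) \<in> borel_measurable (base_space q \<rho>)"
    by (rule borel_measurable_masked[OF f1(1) \<rho>])
  have m2: "(\<lambda>r. ?g2 (fst r) (fst (snd r)) (snd (snd r))) \<in> borel_measurable (base_space q \<rho>)"
    by (rule borel_measurable_masked[OF f2(1) \<rho>])
  have u1: "?g1 N S U \<in> {0..1}" for N S U by (rule masked_unit[OF f1(2)])
  have u2: "?g2 N S U \<in> {0..1}" for N S U by (rule masked_unit[OF f2(2)])
  have u12: "?g1 N S U * ?g2 N S U \<in> {0..1}" for N S U
    using u1[of N S U] u2[of N S U] by (auto intro: mult_le_one)
  have "Exp q \<rho> (\<lambda>z. f1 z * f2 z) =
      (\<integral>r. ?g1 (fst r) (fst (snd r)) (snd (snd r)) * ?g2 (fst r) (fst (snd r)) (snd (snd r)) \<partial>base_space q \<rho>)"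
    unfolding Exp_def
  proof (rule integral_cong_AE)
    show "(\<lambda>r. f1 (outcome r) * f2 (outcome r)) \<in> borel_measurable (base_space q \<rho>)"
      using f1(1) f2(1) \<rho> by (intro borel_measurable_times) (simp_all add: random_var_def)
    show "AE r in base_space q \<rho>. f1 (outcome r) * f2 (outcome r) =
        ?g1 (fst r) (fst (snd r)) (snd (snd r)) * ?g2 (fst r) (fst (snd r)) (snd (snd r))"
      using AE_base_space
    proof eventually_elim
      case (elim r)
      have "f1 (outcome (fst r, fst (snd r), snd (snd r))) = ?g1 (fst r) (fst (snd r)) (snd (snd r))"
        by (rule masked_eq[OF f1(3)]) (use A1 elim in blast)+
      moreover have "f2 (outcome (fst r, fst (snd r), snd (snd r))) = ?g2 (fst r) (fst (snd r)) (snd (snd r))"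
        by (rule masked_eq[OF f2(3)]) (use A2 elim in blast)+
      ultimately show ?case by simp
    qed
  qed (use m1 m2 in auto)
  also have "\<dots> = (\<integral>N. \<integral>S. \<integral>U. ?g1 N S U * ?g2 N S U \<partial>unifs_measure \<partial>steps_measure q \<partial>counts_measure \<rho>)"
    using m1 m2 by (intro integral_base_space(1) u12) auto
  also have "\<dots> = (\<integral>N. (\<integral>S. (\<integral>U. ?g1 N S U \<partial>unifs_measure) * (\<integral>U. ?g2 N S U \<partial>unifs_measure) \<partial>steps_measure q)
      \<partial>counts_measure \<rho>)"
  proof (intro Bochner_Integration.integral_cong refl U.integral_mult_disjoint_coords[where A = D1] u1 u2
      integral_base_space(5)[of ?g1, OF m1 u1] integral_base_space(5)[of ?g2, OF m2 u2])
    fix N S and U U' :: unifs assume "\<And>i. i \<notin> D1 \<Longrightarrow> U i = U' i"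
    then show "?g2 N S U = ?g2 N S U'" using disj(2) by (intro masked_dep) auto
  qed (auto intro!: masked_dep)
  also have "\<dots> = (\<integral>N. (\<integral>S. \<integral>U. ?g1 N S U \<partial>unifs_measure \<partial>steps_measure q) *
      (\<integral>S. \<integral>U. ?g2 N S U \<partial>unifs_measure \<partial>steps_measure q) \<partial>counts_measure \<rho>)"
  proof (intro Bochner_Integration.integral_cong refl S.integral_mult_disjoint_coords[where A = A1]
      prob_space.integral_unit[OF prob_space_unifs] u1 u2 integral_base_space(4)[of ?g1, OF m1 u1] integral_base_space(4)[of ?g2, OF m2 u2])
    fix N U and S S' :: "_ \<Rightarrow> int" assume "\<And>i. i \<notin> A1 \<Longrightarrow> S i = S' i"
    then show "?g2 N S U = ?g2 N S' U" using disj(1) by (intro masked_dep) auto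
  qed (auto intro!: masked_dep)
  finally show ?thesis .
qed

end

section \<open>The trace of the walks in a box\<close>

text \<open>Different walks \<open>(x, k)\<close> read disjoint families of steps, so their traces
  are independent.\<close>

lemma map_pmf_Pi_pmf_Union:
  fixes tr :: "int \<Rightarrow> (int \<Rightarrow> int) \<Rightarrow> 'a set" and T :: "int set" and K :: "(int \<times> nat) set"
  assumes K: "finite K" and T: "finite T"
    and dep: "\<And>x s s'. (\<And>m. m \<in> T \<Longrightarrow> s m = s' m) \<Longrightarrow> tr x s = tr x s'"
  shows "map_pmf (\<lambda>S. \<Union>(x, k)\<in>K. tr x (\<lambda>m. S (x, k, m)))
      (Pi_pmf {(x, k, m). (x, k) \<in> K \<and> m \<in> T} 0 (\<lambda>_. p)) =
    uconv.F (\<lambda>(x, k). map_pmf (tr x) (Pi_pmf T 0 (\<lambda>_. p))) K"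
  using K
proof (induction K rule: finite_induct)
  case empty
  have "{(x, k, m). (x, k) \<in> {} \<and> m \<in> T} = {}" by auto
  then show ?case by simp
next
  case (insert z K)
  obtain x k where z: "z = (x, k)" by fastforce
  define Z where "Z = (\<lambda>m. (x, k, m)) ` T"
  define Q where "Q = {(x, k, m). (x, k) \<in> K \<and> m \<in> T}"
  have Q: "finite Q"
    by (rule finite_subset[of _ "(\<lambda>((x, k), m). (x, k, m)) ` (K \<times> T)"]) (use insert.hyps T in \<open>force simp: Q_def\<close>)+
  have Z: "finite Z" using T by (simp add: Z_def)
  have ZQ: "Z \<inter> Q = {}" using insert.hyps by (auto simp: Z_def Q_def z)
  have split: "{(x', k', m). (x', k') \<in> insert z K \<and> m \<in> T} = Z \<union> Q"
    by (auto simp: Z_def Q_def z)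
  let ?U = "\<lambda>S. \<Union>(x, k)\<in>K. tr x (\<lambda>m. S (x, k, m))"
  have merge: "(\<Union>(x', k')\<in>insert z K. tr x' (\<lambda>m. if (x', k', m) \<in> Z then f (x', k', m) else g (x', k', m))) =
      tr x (\<lambda>m. f (x, k, m)) \<union> ?U g" for f g :: "_ \<Rightarrow> int"
  proof -
    have "tr x (\<lambda>m. if (x, k, m) \<in> Z then f (x, k, m) else g (x, k, m)) = tr x (\<lambda>m. f (x, k, m))"
      by (rule dep) (simp add: Z_def)
    moreover have "tr x' (\<lambda>m. if (x', k', m) \<in> Z then f (x', k', m) else g (x', k', m)) = tr x' (\<lambda>m. g (x', k', m))"
      if "(x', k') \<in> K" for x' k'
    proof -
      have "(x', k', m) \<notin> Z" for m using that insert.hyps by (auto simp: Z_def z)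
      then show ?thesis by simp
    qed
    ultimately show ?thesis by (auto simp: z)
  qed
  \<comment> \<open>\<open>e\<close> lies outside \<open>T\<close> and carries the default value 0;
    sending all indices off \<open>Z\<close> to it makes the reindexed family vanish off
    \<open>Z\<close>.\<close>
  obtain e where e: "e \<notin> T" using ex_new_if_finite[OF infinite_UNIV_int T] by auto
  let ?h = "\<lambda>i. if i \<in> Z then snd (snd i) else e"
  have "Pi_pmf Z 0 (\<lambda>_. p) = map_pmf (\<lambda>g. g \<circ> ?h) (Pi_pmf T 0 (\<lambda>_. p))"
    using Z e by (intro Pi_pmf_bij_betw) (auto simp: bij_betw_def inj_on_def Z_def image_iff)
  then have first: "map_pmf (\<lambda>f. tr x (\<lambda>m. f (x, k, m))) (Pi_pmf Z 0 (\<lambda>_. p)) = map_pmf (tr x) (Pi_pmf T 0 (\<lambda>_. p))"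
    unfolding pmf.map_comp o_def by (auto intro!: map_pmf_cong dep simp: pmf.map_comp o_def Z_def)
  have "map_pmf (\<lambda>S. \<Union>(x', k')\<in>insert z K. tr x' (\<lambda>m. S (x', k', m))) (Pi_pmf (Z \<union> Q) 0 (\<lambda>_. p)) =
      map_pmf (\<lambda>(f, g). tr x (\<lambda>m. f (x, k, m)) \<union> ?U g) (pair_pmf (Pi_pmf Z 0 (\<lambda>_. p)) (Pi_pmf Q 0 (\<lambda>_. p)))"
    unfolding Pi_pmf_union[OF Z Q ZQ] pmf.map_comp o_def case_prod_unfold using merge
    by (intro map_pmf_cong refl) (simp add: case_prod_unfold)
  also have "\<dots> = uconv (map_pmf (\<lambda>f. tr x (\<lambda>m. f (x, k, m))) (Pi_pmf Z 0 (\<lambda>_. p))) (map_pmf ?U (Pi_pmf Q 0 (\<lambda>_. p)))"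
    by (simp add: uconv_def pair_pmf_def map_pmf_def bind_assoc_pmf bind_return_pmf)
  also have "map_pmf ?U (Pi_pmf Q 0 (\<lambda>_. p)) = uconv.F (\<lambda>(x, k). map_pmf (tr x) (Pi_pmf T 0 (\<lambda>_. p))) K"
    using insert.IH by (simp add: Q_def)
  finally show ?case
    unfolding split first using insert.hyps by (simp add: z)
qed

text \<open>Peeling off one site at a time, its Poisson count turns the union of its walks into a
  \<open>cpois\<close> law.\<close>

lemma bind_Pi_pmf_poisson:
  assumes "finite J"
  shows "bind_pmf (Pi_pmf J 0 (\<lambda>_. poisson_pmf \<rho>)) (\<lambda>N. uconv.F (\<lambda>(x, k). \<nu> x) (SIGMA x:J. {..<N x})) =
    uconv.F (\<lambda>x. cpois \<rho> (\<nu> x)) J"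
proof -
  have "bind_pmf (Pi_pmf J 0 (\<lambda>_. poisson_pmf \<rho>)) (\<lambda>N. uconv.F (\<lambda>x. uconv.F (\<lambda>_. \<nu> x) {..<N x}) J) =
      uconv.F (\<lambda>x. cpois \<rho> (\<nu> x)) J"
    using assms
  proof (induction J rule: finite_induct)
    case (insert x J)
    have "uconv.F (\<lambda>x'. uconv.F (\<lambda>_. \<nu> x') {..<(N(x := y)) x'}) (insert x J) =
        uconv (uconv.F (\<lambda>_. \<nu> x) {..<y}) (uconv.F (\<lambda>x. uconv.F (\<lambda>_. \<nu> x) {..<N x}) J)" for N y
    proof -
      have "uconv.F (\<lambda>x'. uconv.F (\<lambda>_. \<nu> x') {..<(N(x := y)) x'}) J = uconv.F (\<lambda>x. uconv.F (\<lambda>_. \<nu> x) {..<N x}) J"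
      proof (rule uconv.cong)
        fix x' assume "x' \<in> J"
        then have "x' \<noteq> x" using insert.hyps by auto
        then show "uconv.F (\<lambda>_. \<nu> x') {..<(N(x := y)) x'} = uconv.F (\<lambda>_. \<nu> x') {..<N x'}" by simp
      qed simp
      then show ?thesis by (simp only: uconv.insert[OF insert.hyps] fun_upd_same)
    qed
    note upd = this
    have "bind_pmf (Pi_pmf (insert x J) 0 (\<lambda>_. poisson_pmf \<rho>)) F = bind_pmf (poisson_pmf \<rho>)
        (\<lambda>y. bind_pmf (Pi_pmf J 0 (\<lambda>_. poisson_pmf \<rho>)) (\<lambda>N. F (N(x := y))))" for F :: "_ \<Rightarrow> 'b set pmf"
      using insert.hyps
      by (simp add: Pi_pmf_insert bind_map_pmf pair_pmf_def bind_assoc_pmf bind_return_pmf)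
    then have "bind_pmf (Pi_pmf (insert x J) 0 (\<lambda>_. poisson_pmf \<rho>))
        (\<lambda>N. uconv.F (\<lambda>x. uconv.F (\<lambda>_. \<nu> x) {..<N x}) (insert x J)) =
      bind_pmf (poisson_pmf \<rho>) (\<lambda>y. bind_pmf (Pi_pmf J 0 (\<lambda>_. poisson_pmf \<rho>))
        (\<lambda>N. uconv (uconv.F (\<lambda>_. \<nu> x) {..<y}) (uconv.F (\<lambda>x. uconv.F (\<lambda>_. \<nu> x) {..<N x}) J)))"
      by (simp only: upd)
    also have "\<dots> = uconv (cpois \<rho> (\<nu> x))
        (bind_pmf (Pi_pmf J 0 (\<lambda>_. poisson_pmf \<rho>)) (\<lambda>N. uconv.F (\<lambda>x. uconv.F (\<lambda>_. \<nu> x) {..<N x}) J))"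
    proof -
      have "bind_pmf P (\<lambda>N. uconv (a :: 'b set pmf) (b N)) = uconv a (bind_pmf P b)" for P :: "('a \<Rightarrow> nat) pmf" and a b
        unfolding uconv_def by (subst bind_commute_pmf) (simp add: bind_assoc_pmf)
      moreover have "bind_pmf P (\<lambda>y. uconv (a y) (b :: 'b set pmf)) = uconv (bind_pmf P a) b" for P :: "nat pmf" and a b
        by (simp add: uconv_def bind_assoc_pmf)
      ultimately show ?thesis by (simp add: cpois_def)
    qed
    also have "\<dots> = uconv.F (\<lambda>x. cpois \<rho> (\<nu> x)) (insert x J)"
      using insert by simp
    finally show ?case .
  qed (simp add: bind_return_pmf)
  then show ?thesis
    using assms by (subst uconv.Sigma[symmetric]) auto
qed

section \<open>The trace of a single walk in the box\<close>

definition trail :: "(int \<times> int) set \<Rightarrow> int \<Rightarrow> int \<Rightarrow> (int \<Rightarrow> int) \<Rightarrow> (int \<times> int) set" where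
  "trail B y t0 s = B \<inter> (\<lambda>t. (y + sum s {t0..<t}, t)) ` {t0..}"

lemma mem_trail: "(z, t) \<in> trail B y t0 s \<longleftrightarrow> (z, t) \<in> B \<and> t0 \<le> t \<and> z = y + sum s {t0..<t}"
  by (auto simp: trail_def)

lemma trail_box_dep:
  assumes "\<And>m. m \<in> {t0..<n'} \<Longrightarrow> s m = s' m"
  shows "trail (box a b n n') y t0 s = trail (box a b n n') y t0 s'"
proof -
  have "sum s {t0..<t} = sum s' {t0..<t}" if "t \<le> n'" for t
    using that assms by (intro sum.cong) auto
  then have "(z, t) \<in> trail (box a b n n') y t0 s \<longleftrightarrow> (z, t) \<in> trail (box a b n n') y t0 s'" for z t
    by (cases "t \<le> n'") (simp_all add: mem_trail box_def)
  then show ?thesis by auto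
qed

text \<open>The box starts at time \<open>n\<close>, so nothing is recorded earlier, and the earlier
  steps matter only through the position at time \<open>n\<close>.\<close>

lemma trail_restart:
  assumes "0 \<le> n"
  shows "trail (box a b n n') x 0 s = trail (box a b n n') (x + sum s {0..<n}) n s"
proof -
  have eq: "sum s {0..<t} = sum s {0..<n} + sum s {n..<t}" if "n \<le> t" for t
  proof -
    have "{0..<t} = {0..<n} \<union> {n..<t}" using that assms by auto
    then show ?thesis by (simp add: sum.union_disjoint)
  qed
  have "(z, t) \<in> trail (box a b n n') x 0 s \<longleftrightarrow> (z, t) \<in> trail (box a b n n') (x + sum s {0..<n}) n s" for z t
  proof (cases "n \<le> t")
    case True
    then show ?thesis using assms by (simp add: mem_trail eq[OF True] add.assoc)
  qed (simp add: mem_trail box_def)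
  then show ?thesis by auto
qed

lemma abs_sum_le_length:
  fixes s :: "int \<Rightarrow> int"
  assumes "\<And>i. \<bar>s i\<bar> \<le> 1" "t0 \<le> t"
  shows "\<bar>sum s {t0..<t}\<bar> \<le> t - t0"
proof -
  have "\<bar>sum s {t0..<t}\<bar> \<le> (\<Sum>i\<in>{t0..<t}. 1)"
    using assms(1) by (intro order.trans[OF sum_abs] sum_mono) auto
  then show ?thesis using assms(2) by simp
qed

lemma Pi_pmf_step_bounds:
  assumes "0 < q" "q < 1" "finite Q" "S \<in> set_pmf (Pi_pmf Q 0 (\<lambda>_. step_pmf q))"
  shows "S i \<in> {-1, 0, 1}"
proof (cases "i \<in> Q")
  case True
  then have "S i \<in> set_pmf (step_pmf q)"
    using assms(4) unfolding set_Pi_pmf[OF assms(3)] PiE_dflt_def by simp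
  then show ?thesis using set_step_pmf[OF assms(1,2)] by blast
next
  case False
  then show ?thesis using assms(4) unfolding set_Pi_pmf[OF assms(3)] PiE_dflt_def by simp
qed

text \<open>The Markov property at time \<open>n\<close>, in the form \<open>particle\<close> to
  which the cell comparison applies.\<close>

lemma trail_pmf_markov:
  assumes q: "0 < q" "q < 1" and n: "0 \<le> n" "n \<le> n'"
  shows "map_pmf (trail (box a b n n') x 0) (Pi_pmf {0..<n'} 0 (\<lambda>_. step_pmf q)) =
    particle (srw q (nat n)) (\<lambda>y. map_pmf (trail (box a b n n') y n) (Pi_pmf {n..<n'} 0 (\<lambda>_. step_pmf q))) x"
proof -
  let ?B = "box a b n n'"
  let ?P = "\<lambda>A. Pi_pmf A 0 (\<lambda>_ :: int. step_pmf q)"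
  have split: "{0..<n'} = {0..<n} \<union> {n..<n'}" using n by auto
  have "trail ?B x 0 (\<lambda>i. if i \<in> {0..<n} then f i else g i) = trail ?B (x + sum f {0..<n}) n g" for f g
  proof -
    have "trail ?B x 0 (\<lambda>i. if i \<in> {0..<n} then f i else g i) =
        trail ?B (x + sum (\<lambda>i. if i \<in> {0..<n} then f i else g i) {0..<n}) n (\<lambda>i. if i \<in> {0..<n} then f i else g i)"
      by (rule trail_restart[OF n(1)])
    also have "sum (\<lambda>i. if i \<in> {0..<n} then f i else g i) {0..<n} = sum f {0..<n}"
      by (intro sum.cong) auto
    also have "trail ?B (x + sum f {0..<n}) n (\<lambda>i. if i \<in> {0..<n} then f i else g i) = trail ?B (x + sum f {0..<n}) n g"
      by (rule trail_box_dep) auto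
    finally show ?thesis .
  qed
  then have "map_pmf (trail ?B x 0) (?P {0..<n'}) =
      map_pmf (\<lambda>(f, g). trail ?B (x + sum f {0..<n}) n g) (pair_pmf (?P {0..<n}) (?P {n..<n'}))"
    unfolding split by (subst Pi_pmf_union) (auto simp: pmf.map_comp o_def case_prod_unfold)
  also have "\<dots> = bind_pmf (map_pmf (\<lambda>s. x + sum s {0..<n}) (?P {0..<n})) (\<lambda>y. map_pmf (trail ?B y n) (?P {n..<n'}))"
    by (simp add: pair_pmf_def map_pmf_def bind_assoc_pmf bind_return_pmf)
  finally show ?thesis
    using srw_eq_sum_Pi_pmf[OF q, of "nat n"] n by (simp add: particle_def pmf.map_comp o_def)
qed

text \<open>The largest configuration with trace inside \<open>T\<close> makes sense, and is monotone in \<open>T\<close>, even for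
  sets \<open>T\<close> that are not the trace of a configuration.\<close>

definition on_trace :: "(config \<times> unifs \<Rightarrow> real) \<Rightarrow> (int \<times> int) set \<Rightarrow> unifs \<Rightarrow> (int \<times> int) set \<Rightarrow> real" where
  "on_trace f B \<xi> T = f ({w \<in> Wpaths. \<forall>t. (w t, t) \<in> B \<longrightarrow> (w t, t) \<in> T}, \<xi>)"

lemma on_trace_in_Omega:
  "(\<And>y. \<xi> y \<in> {0..1}) \<Longrightarrow> ({w \<in> Wpaths. \<forall>t. (w t, t) \<in> B \<longrightarrow> (w t, t) \<in> T}, \<xi>) \<in> Omega"
  by (auto simp: Omega_def)

lemma antimono_on_trace:
  assumes "nonincreasing f" "\<And>y. \<xi> y \<in> {0..1}"
  shows "antimono (on_trace f B \<xi>)"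
proof (rule antimonoI)
  fix T T' :: "(int \<times> int) set" assume "T \<le> T'"
  then have "traj {w \<in> Wpaths. \<forall>t. (w t, t) \<in> B \<longrightarrow> (w t, t) \<in> T}
      \<subseteq> traj {w \<in> Wpaths. \<forall>t. (w t, t) \<in> B \<longrightarrow> (w t, t) \<in> T'}"
    unfolding traj_def by blast
  then show "on_trace f B \<xi> T' \<le> on_trace f B \<xi> T"
    using assms(1) on_trace_in_Omega[of \<xi>, OF assms(2)] unfolding nonincreasing_def on_trace_def by blast
qed

lemma on_trace_traj:
  assumes "has_support f B" "(\<omega>, \<xi>) \<in> Omega"
  shows "f (\<omega>, \<xi>) = on_trace f B \<xi> (traj \<omega> \<inter> B)"
proof -
  let ?\<omega>' = "{w \<in> Wpaths. \<forall>t. (w t, t) \<in> B \<longrightarrow> (w t, t) \<in> traj \<omega> \<inter> B}"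
  have "\<omega> \<subseteq> ?\<omega>'" using assms(2) by (auto simp: Omega_def traj_def)
  \<comment> \<open>The maximal configuration contains \<omega>, and its paths meet \<open>B\<close>
    only inside \<open>traj \<omega>\<close>.\<close>
  then have "traj \<omega> \<inter> B = traj ?\<omega>' \<inter> B" by (fastforce simp: traj_def)
  moreover have "(?\<omega>', \<xi>) \<in> Omega" using assms(2) by (intro on_trace_in_Omega) (auto simp: Omega_def)
  ultimately show ?thesis
    using assms unfolding has_support_def on_trace_def by blast
qed

lemma mask_unifs_unit: "mask_unifs D U y \<in> {0..1}"
  by (simp add: mask_unifs_def clip_unif_def)

section \<open>The law of the future given the counts, and averaged over them\<close>

context
  fixes q :: real and a b n n' :: int and J :: "int set" and f :: "config \<times> unifs \<Rightarrow> real"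
  assumes q: "0 < q" "q < 1" and n: "0 < n" "n \<le> n'"
    and J: "finite J" "{a - n'..b + n'} \<subseteq> J"
    and f: "has_support f (box a b n n')" "\<And>z. z \<in> Omega \<Longrightarrow> f z \<in> {0..1}"
begin

lemma on_trace_unit: "on_trace f B (mask_unifs D U) T \<in> {0..1}"
  unfolding on_trace_def by (intro f(2) on_trace_in_Omega mask_unifs_unit)

text \<open>Walks have speed at most 1, so only starts in \<open>{a - n'..b + n'}\<close> can show
  in the box; this reduces the infinite cloud to finitely many walks.\<close>

lemma traj_conf_box:
  assumes S: "\<And>i. \<bar>S i\<bar> \<le> 1"
  shows "traj (conf_of (N, S, U)) \<inter> box a b n n' =
    (\<Union>(x, k)\<in>(SIGMA x:J. {..<N x}). trail (box a b n n') x 0 (\<lambda>m. S (x, k, m)))"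
proof -
  have "(y, t) \<in> traj (conf_of (N, S, U)) \<longleftrightarrow>
      (y, t) \<in> (\<Union>(x, k)\<in>(SIGMA x:J. {..<N x}). trail (box a b n n') x 0 (\<lambda>m. S (x, k, m)))"
    if yt: "(y, t) \<in> box a b n n'" for y t
  proof -
    have t: "0 \<le> t" "t \<le> n'" "a \<le> y" "y \<le> b" using yt n by (auto simp: box_def)
    have "x \<in> J" if "x + (\<Sum>i\<in>{0..<t}. S (x, k, i)) = y" for x k
      using abs_sum_le_length[of "\<lambda>i. S (x, k, i)" 0 t] S t that J(2) by (intro subsetD[OF J(2)]) auto
    then show ?thesis using yt t by (auto simp: traj_conf_of walk_def mem_trail)
  qed
  moreover have "trail B x 0 s \<subseteq> B" for B x s by (auto simp: trail_def)
  ultimately show ?thesis by fast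
qed

lemma masked_eq_on_trace:
  "masked {(x, k, m). 0 \<le> m} (box a b n n') f N S U =
    on_trace f (box a b n n') (mask_unifs (box a b n n') U)
      (\<Union>(x, k)\<in>(SIGMA x:J. {..<N x}). trail (box a b n n') x 0 (\<lambda>m. clip_step (S (x, k, m))))"
proof -
  let ?S = "mask_steps {(x, k, m). 0 \<le> m} S"
  have "trail (box a b n n') x 0 (\<lambda>m. ?S (x, k, m)) = trail (box a b n n') x 0 (\<lambda>m. clip_step (S (x, k, m)))" for x k
    by (rule trail_box_dep) (simp add: mask_steps_def)
  then have "traj (conf_of (N, ?S, mask_unifs (box a b n n') U)) \<inter> box a b n n' =
      (\<Union>(x, k)\<in>(SIGMA x:J. {..<N x}). trail (box a b n n') x 0 (\<lambda>m. clip_step (S (x, k, m))))"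
    using traj_conf_box[of ?S, OF mask_steps_bounds] by simp
  moreover have "(conf_of (N, ?S, mask_unifs (box a b n n') U), mask_unifs (box a b n n') U) \<in> Omega"
    using masked_in_Omega[of N] by (simp add: outcome_def)
  ultimately show ?thesis
    using on_trace_traj[OF f(1)] by (simp add: masked_def outcome_def)
qed

text \<open>For fixed \<open>N\<close> and \<open>U\<close> only the finitely many steps in
  \<open>Q\<close> matter. On the finite product the clipping is invisible, because the steps and
  the default 0 are legal values.\<close>

lemma quenched_expectation:
  "(\<integral>S. masked {(x, k, m). 0 \<le> m} (box a b n n') f N S U \<partial>steps_measure q) =
    measure_pmf.expectation
      (uconv.F (\<lambda>(x, k). map_pmf (trail (box a b n n') x 0) (Pi_pmf {0..<n'} 0 (\<lambda>_. step_pmf q)))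
        (SIGMA x:J. {..<N x}))
      (on_trace f (box a b n n') (mask_unifs (box a b n n') U))"
proof -
  let ?B = "box a b n n'" and ?K = "SIGMA x:J. {..<N x}"
  let ?\<phi> = "on_trace f ?B (mask_unifs ?B U)"
  define Q where "Q = {(x, k, m). (x, k) \<in> ?K \<and> m \<in> {0..<n'}}"
  have K: "finite ?K" using J(1) by simp
  have Q: "finite Q"
    by (rule finite_subset[of _ "(\<lambda>((x, k), m). (x, k, m)) ` (?K \<times> {0..<n'})"]) (use K in \<open>force simp: Q_def\<close>)+
  have "(\<integral>S. masked {(x, k, m). 0 \<le> m} ?B f N S U \<partial>steps_measure q) =
      (\<integral>S. ?\<phi> (\<Union>(x, k)\<in>?K. trail ?B x 0 (\<lambda>m. clip_step (S (x, k, m)))) \<partial>steps_measure q)"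
    by (simp only: masked_eq_on_trace)
  also have "\<dots> = measure_pmf.expectation (Pi_pmf Q 0 (\<lambda>_. step_pmf q))
      (\<lambda>S. ?\<phi> (\<Union>(x, k)\<in>?K. trail ?B x 0 (\<lambda>m. clip_step (S (x, k, m)))))"
  proof (rule integral_PiM_finite_dep[OF Q])
    fix S S' :: "int \<times> nat \<times> int \<Rightarrow> int" assume eq: "\<And>i. i \<in> Q \<Longrightarrow> S i = S' i"
    have "trail ?B x 0 (\<lambda>m. clip_step (S (x, k, m))) = trail ?B x 0 (\<lambda>m. clip_step (S' (x, k, m)))"
      if "(x, k) \<in> ?K" for x k
      using that eq by (intro trail_box_dep) (simp add: Q_def)
    then have "(\<Union>(x, k)\<in>?K. trail ?B x 0 (\<lambda>m. clip_step (S (x, k, m)))) =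
        (\<Union>(x, k)\<in>?K. trail ?B x 0 (\<lambda>m. clip_step (S' (x, k, m))))"
      by (intro SUP_cong refl) auto
    then show "?\<phi> (\<Union>(x, k)\<in>?K. trail ?B x 0 (\<lambda>m. clip_step (S (x, k, m)))) =
        ?\<phi> (\<Union>(x, k)\<in>?K. trail ?B x 0 (\<lambda>m. clip_step (S' (x, k, m))))" by simp
  qed
  also have "\<dots> = measure_pmf.expectation (Pi_pmf Q 0 (\<lambda>_. step_pmf q))
      (\<lambda>S. ?\<phi> (\<Union>(x, k)\<in>?K. trail ?B x 0 (\<lambda>m. S (x, k, m))))"
  proof (intro integral_cong_AE AE_pmfI)
    fix S assume S: "S \<in> set_pmf (Pi_pmf Q 0 (\<lambda>_. step_pmf q))"
    have "clip_step (S i) = S i" for i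
      unfolding clip_step_def by (rule if_P) (rule Pi_pmf_step_bounds[OF q Q S])
    then show "?\<phi> (\<Union>(x, k)\<in>?K. trail ?B x 0 (\<lambda>m. clip_step (S (x, k, m)))) =
        ?\<phi> (\<Union>(x, k)\<in>?K. trail ?B x 0 (\<lambda>m. S (x, k, m)))" by simp
  qed simp_all
  also have "\<dots> = measure_pmf.expectation (map_pmf (\<lambda>S. \<Union>(x, k)\<in>?K. trail ?B x 0 (\<lambda>m. S (x, k, m)))
      (Pi_pmf Q 0 (\<lambda>_. step_pmf q))) ?\<phi>"
    by simp
  also have "map_pmf (\<lambda>S. \<Union>(x, k)\<in>?K. trail ?B x 0 (\<lambda>m. S (x, k, m))) (Pi_pmf Q 0 (\<lambda>_. step_pmf q)) =
      uconv.F (\<lambda>(x, k). map_pmf (trail ?B x 0) (Pi_pmf {0..<n'} 0 (\<lambda>_. step_pmf q))) ?K"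
    unfolding Q_def
    by (rule map_pmf_Pi_pmf_Union[where tr = "\<lambda>x. trail ?B x 0"]) (rule K, simp, rule trail_box_dep, simp)
  finally show ?thesis .
qed

text \<open>Averaging over Poisson counts turns fixed numbers of walks into \<open>cpois\<close>
  laws, the target of the domination.\<close>

lemma annealed_expectation:
  "(\<integral>N. \<integral>S. masked {(x, k, m). 0 \<le> m} (box a b n n') f N S U \<partial>steps_measure q \<partial>counts_measure \<rho>) =
    measure_pmf.expectation
      (uconv.F (\<lambda>x. cpois \<rho> (map_pmf (trail (box a b n n') x 0) (Pi_pmf {0..<n'} 0 (\<lambda>_. step_pmf q)))) J)
      (on_trace f (box a b n n') (mask_unifs (box a b n n') U))"
proof -
  let ?\<phi> = "on_trace f (box a b n n') (mask_unifs (box a b n n') U)"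
  let ?\<nu> = "\<lambda>x. map_pmf (trail (box a b n n') x 0) (Pi_pmf {0..<n'} 0 (\<lambda>_. step_pmf q))"
  have "(\<integral>N. \<integral>S. masked {(x, k, m). 0 \<le> m} (box a b n n') f N S U \<partial>steps_measure q \<partial>counts_measure \<rho>) =
      (\<integral>N. measure_pmf.expectation (uconv.F (\<lambda>(x, k). ?\<nu> x) (SIGMA x:J. {..<N x})) ?\<phi> \<partial>counts_measure \<rho>)"
    by (simp only: quenched_expectation)
  also have "\<dots> = measure_pmf.expectation (Pi_pmf J 0 (\<lambda>_. poisson_pmf \<rho>))
      (\<lambda>N. measure_pmf.expectation (uconv.F (\<lambda>(x, k). ?\<nu> x) (SIGMA x:J. {..<N x})) ?\<phi>)"
  proof (rule integral_PiM_finite_dep[OF J(1)])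
    fix N N' :: "int \<Rightarrow> nat" assume "\<And>x. x \<in> J \<Longrightarrow> N x = N' x"
    then have "(SIGMA x:J. {..<N x}) = (SIGMA x:J. {..<N' x})" by auto
    then show "measure_pmf.expectation (uconv.F (\<lambda>(x, k). ?\<nu> x) (SIGMA x:J. {..<N x})) ?\<phi> =
        measure_pmf.expectation (uconv.F (\<lambda>(x, k). ?\<nu> x) (SIGMA x:J. {..<N' x})) ?\<phi>" by simp
  qed
  also have "\<dots> = measure_pmf.expectation (bind_pmf (Pi_pmf J 0 (\<lambda>_. poisson_pmf \<rho>))
      (\<lambda>N. uconv.F (\<lambda>(x, k). ?\<nu> x) (SIGMA x:J. {..<N x}))) ?\<phi>"
    by (rule expectation_bind_unit[symmetric]) (rule on_trace_unit)
  finally show ?thesis by (simp only: bind_Pi_pmf_poisson[OF J(1)])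
qed

end

text \<open>For fixed uniforms \<open>f\<close> is an antitone function of the trace, to which the
  domination of dense cells over the Poisson cloud applies once the walks are restarted at time
  \<open>n\<close>.\<close>

lemma quenched_le_annealed:
  fixes f :: "config \<times> unifs \<Rightarrow> real"
  assumes q: "0 < q" "q < 1" and n: "0 < n" "n \<le> n'"
    and f: "has_support f (box a b n n')" "\<And>z. z \<in> Omega \<Longrightarrow> f z \<in> {0..1}" "nonincreasing f"
    and l: "0 < l" and R: "b - a + 2 * n' < int (R * l)"
    and \<rho>: "0 < \<rho>" "\<rho> \<le> \<theta> * (1 - real l * sqrt ((1 / q + 2 / (1 - q)) / real (Suc (nat n))))" and \<theta>: "0 < \<theta>"
    and dense: "\<And>j. j < R \<Longrightarrow> M \<le> (\<Sum>x\<in>cell (a - n') l j. N x)"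
  shows "(\<integral>S. masked {(x, k, m). 0 \<le> m} (box a b n n') f N S U \<partial>steps_measure q) \<le>
    (\<integral>N. \<integral>S. masked {(x, k, m). 0 \<le> m} (box a b n n') f N S U \<partial>steps_measure q \<partial>counts_measure \<rho>) +
    real R * measure_pmf.prob (poisson_pmf (\<theta> * real l)) {M<..}"
proof -
  let ?B = "box a b n n'"
  let ?J = "{a - n'..<a - n' + int (R * l)}"
  let ?\<kappa> = "\<lambda>y. map_pmf (trail ?B y n) (Pi_pmf {n..<n'} 0 (\<lambda>_. step_pmf q))"
  let ?Y = "{a - (n' - n)..b + (n' - n)}"
  have J: "finite ?J" "{a - n'..b + n'} \<subseteq> ?J" using R by auto
  \<comment> \<open>A walk outside \<open>?Y\<close> at time \<open>n\<close> cannot reach the box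
    by time \<open>n'\<close>.\<close>
  have off: "?\<kappa> y = return_pmf {}" if "y \<notin> ?Y" for y
  proof -
    have "?\<kappa> y = map_pmf (\<lambda>_. {}) (Pi_pmf {n..<n'} 0 (\<lambda>_. step_pmf q))"
    proof (intro map_pmf_cong refl)
      fix s assume s: "s \<in> set_pmf (Pi_pmf {n..<n'} 0 (\<lambda>_. step_pmf q))"
      have "\<bar>s i\<bar> \<le> 1" for i using Pi_pmf_step_bounds[OF q _ s, of i] by auto
      then have "\<bar>sum s {n..<t}\<bar> \<le> t - n" if "n \<le> t" for t using that by (rule abs_sum_le_length)
      then have "(z, t) \<notin> trail ?B y n s" for z t
        using \<open>y \<notin> ?Y\<close> by (fastforce simp: mem_trail box_def)
      then show "trail ?B y n s = {}" by auto
    qed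
    then show ?thesis by simp
  qed
  have "dominates_upto (real R * measure_pmf.prob (poisson_pmf (\<theta> * real l)) {M<..})
    (uconv.F (\<lambda>(x, k). particle (srw q (nat n)) ?\<kappa> x) (SIGMA x:?J. {..<N x}))
    (uconv.F (\<lambda>z. cpois \<rho> (particle (srw q (nat n)) ?\<kappa> z)) ?J)"
  proof (rule dense_cells_dominate_poisson[where Y = ?Y and B = ?B])
    show "(\<Sum>u\<in>A. \<bar>pmf (srw q (nat n)) (u + 1) - pmf (srw q (nat n)) u\<bar>)
        \<le> sqrt ((1 / q + 2 / (1 - q)) / real (Suc (nat n)))" if "finite A" for A
      using srw_variation[OF q that] .
    \<comment> \<open>The start is within \<open>n\<close> of a point that is within
      \<open>n' - n\<close> of \<open>{a..b}\<close>, so a margin of \<open>n'\<close>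
      suffices.\<close>
    show "y - d \<in> ?J" if "y \<in> ?Y" "d \<in> set_pmf (srw q (nat n))" for y d
      using that set_srw[OF q, of "nat n"] n R by fastforce
    show "finite ?B" by (simp add: box_def)
    show "set_pmf (?\<kappa> y) \<subseteq> Pow ?B" for y by (auto simp: trail_def)
  qed (use off l \<rho> \<theta> dense in auto)
  then have dom: "dominates_upto (real R * measure_pmf.prob (poisson_pmf (\<theta> * real l)) {M<..})
    (uconv.F (\<lambda>(x, k). map_pmf (trail ?B x 0) (Pi_pmf {0..<n'} 0 (\<lambda>_. step_pmf q))) (SIGMA x:?J. {..<N x}))
    (uconv.F (\<lambda>x. cpois \<rho> (map_pmf (trail ?B x 0) (Pi_pmf {0..<n'} 0 (\<lambda>_. step_pmf q)))) ?J)"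
    using n by (simp only: trail_pmf_markov[OF q less_imp_le[OF n(1)] n(2)])
  have "measure_pmf.expectation
      (uconv.F (\<lambda>(x, k). map_pmf (trail ?B x 0) (Pi_pmf {0..<n'} 0 (\<lambda>_. step_pmf q))) (SIGMA x:?J. {..<N x}))
      (on_trace f ?B (mask_unifs ?B U)) \<le>
    measure_pmf.expectation
      (uconv.F (\<lambda>x. cpois \<rho> (map_pmf (trail ?B x 0) (Pi_pmf {0..<n'} 0 (\<lambda>_. step_pmf q)))) ?J)
      (on_trace f ?B (mask_unifs ?B U)) + real R * measure_pmf.prob (poisson_pmf (\<theta> * real l)) {M<..}"
    by (intro dominates_uptoD[OF dom] antimono_on_trace f(3) mask_unifs_unit on_trace_unit[OF q n J f(1,2)])
  note le = this
  show ?thesis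
    by (subst annealed_expectation[OF q n J f(1)], erule f(2),
        subst quenched_expectation[OF q n J f(1)], erule f(2), rule le)
qed

section \<open>The decoupling inequality\<close>

lemma sets_sum_less:
  fixes A :: "'i set"
  assumes "finite A"
  shows "{N. (\<Sum>x\<in>A. N x) < M} \<in> sets (PiM UNIV (\<lambda>_. measure_pmf (p :: nat pmf)))"
proof -
  let ?P = "PiM UNIV (\<lambda>_ :: 'i. measure_pmf p)"
  have "(\<lambda>N. real (\<Sum>x\<in>A. N x)) \<in> borel_measurable ?P"
    using assms by (intro borel_measurable_PiM_finite_dep[OF assms]) simp
  then have "{N \<in> space ?P. real (\<Sum>x\<in>A. N x) < real M} \<in> sets ?P"
    by (rule borel_measurable_less) simp
  then show ?thesis by (simp add: space_PiM of_nat_less_iff del: of_nat_sum)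
qed

text \<open>The inequality with all parameters still free. The two errors are a Poisson variable
  above the threshold \<open>M\<close> and a cell with fewer than \<open>M\<close> particles, each
  summed over the \<open>R\<close> cells.\<close>

lemma decoupling:
  fixes f1 f2 :: "config \<times> unifs \<Rightarrow> real"
  assumes q: "0 < q" "q < 1" and n: "0 < n" "n \<le> n'"
    and f1: "random_var q f1" "\<And>z. z \<in> Omega \<Longrightarrow> f1 z \<in> {0..1}" "has_support f1 Dneg"
    and f2: "random_var q f2" "\<And>z. z \<in> Omega \<Longrightarrow> f2 z \<in> {0..1}" "has_support f2 (box a b n n')" "nonincreasing f2"
    and l: "0 < l" and R: "b - a + 2 * n' < int (R * l)"
    and \<rho>: "0 < \<rho>" "\<rho> \<le> \<theta> * (1 - real l * sqrt ((1 / q + 2 / (1 - q)) / real (Suc (nat n))))" and \<theta>: "0 < \<theta>"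
    and \<rho>': "0 < \<rho>'" and t: "0 < t"
  shows "Exp q \<rho>' (\<lambda>z. f1 z * f2 z) \<le> Exp q \<rho>' f1 * Exp q \<rho> f2 +
    real R * measure_pmf.prob (poisson_pmf (\<theta> * real l)) {M<..} +
    real R * exp (t * real M - \<rho>' * real l * (1 - exp (- t)))"
proof -
  let ?B = "box a b n n'"
  \<comment> \<open>The step with index \<open>m\<close> leads from time \<open>m\<close> to
    \<open>m + 1\<close>, so the walk uses only negative indices up to time 0 and only nonnegative
    ones afterwards.\<close>
  define A1 A2 :: "(int \<times> nat \<times> int) set" where "A1 = {(x, k, m). m < 0}" and "A2 = {(x, k, m). 0 \<le> m}"
  have A1: "(x, k, m) \<in> A1" if "(y, s) \<in> Dneg" "0 \<le> m \<and> m < s \<or> s \<le> m \<and> m < 0" for x k y s m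
    using that by (auto simp: A1_def Dneg_def)
  have A2: "(x, k, m) \<in> A2" if "(y, s) \<in> ?B" "0 \<le> m \<and> m < s \<or> s \<le> m \<and> m < 0" for x k y s m
    using that n by (auto simp: A2_def box_def)
  have disj: "A1 \<inter> A2 = {}" "Dneg \<inter> ?B = {}"
    using n by (auto simp: A1_def A2_def Dneg_def box_def)
  let ?g1 = "masked A1 Dneg f1" and ?g2 = "masked A2 ?B f2"
  let ?PN = "counts_measure \<rho>'"
  have m1: "(\<lambda>r. ?g1 (fst r) (fst (snd r)) (snd (snd r))) \<in> borel_measurable (base_space q \<sigma>)" if "0 < \<sigma>" for \<sigma>
    by (rule borel_measurable_masked[OF f1(1) that])
  have m2: "(\<lambda>r. ?g2 (fst r) (fst (snd r)) (snd (snd r))) \<in> borel_measurable (base_space q \<sigma>)" if "0 < \<sigma>" for \<sigma>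
    by (rule borel_measurable_masked[OF f2(1) that])
  have u1: "?g1 N S U \<in> {0..1}" for N S U by (rule masked_unit[OF f1(2)])
  have u2: "?g2 N S U \<in> {0..1}" for N S U by (rule masked_unit[OF f2(2)])
  interpret N: prob_space ?PN by (rule prob_space_counts)
  interpret U: prob_space unifs_measure by (rule prob_space_unifs)
  define h1 where "h1 N = (\<integral>S. \<integral>U. ?g1 N S U \<partial>unifs_measure \<partial>steps_measure q)" for N
  define h2 where "h2 N = (\<integral>S. \<integral>U. ?g2 N S U \<partial>unifs_measure \<partial>steps_measure q)" for N
  have h1: "h1 N \<in> {0..1}" and h2: "h2 N \<in> {0..1}" for N
    unfolding h1_def h2_def by (intro prob_space.integral_unit[OF prob_space_steps] U.integral_unit u1 u2)+
  have h1_meas: "h1 \<in> borel_measurable ?PN" and h2_meas: "h2 \<in> borel_measurable ?PN"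
    using integral_base_space(3)[OF q \<rho>', of ?g1, OF m1[OF \<rho>'] u1] integral_base_space(3)[OF q \<rho>', of ?g2, OF m2[OF \<rho>'] u2]
    by (simp_all add: h1_def[abs_def] h2_def[abs_def])
  have E12: "Exp q \<rho>' (\<lambda>z. f1 z * f2 z) = (\<integral>N. h1 N * h2 N \<partial>?PN)"
    unfolding h1_def h2_def by (rule Exp_mult_eq[OF q \<rho>' f1(1,2,3) A1 f2(1,2,3) A2 disj])
  have E1: "Exp q \<rho>' f1 = (\<integral>N. h1 N \<partial>?PN)"
    unfolding h1_def by (rule Exp_eq_masked[OF q \<rho>' f1(1,2,3) A1])
  define e2 where "e2 = Exp q \<rho> f2"
  have "e2 = (\<integral>N. \<integral>S. \<integral>U. ?g2 N S U \<partial>unifs_measure \<partial>steps_measure q \<partial>counts_measure \<rho>)"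
    unfolding e2_def by (rule Exp_eq_masked[OF q \<rho>(1) f2(1,2,3) A2])
  also have "\<dots> = (\<integral>U. \<integral>N. \<integral>S. ?g2 N S U \<partial>steps_measure q \<partial>counts_measure \<rho> \<partial>unifs_measure)"
    by (rule integral_base_space(8)[OF q \<rho>(1) m2[OF \<rho>(1)] u2])
  finally have e2: "e2 = (\<integral>U. \<integral>N. \<integral>S. ?g2 N S U \<partial>steps_measure q \<partial>counts_measure \<rho> \<partial>unifs_measure)" .
  have units: "(\<integral>S. ?g2 N S U \<partial>steps_measure q) \<in> {0..1}"
    "(\<integral>N. \<integral>S. ?g2 N S U \<partial>steps_measure q \<partial>counts_measure \<rho>) \<in> {0..1}" for N U
    by (intro prob_space.integral_unit[OF prob_space_steps] prob_space.integral_unit[OF prob_space_counts] u2)+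
  have e2_nonneg: "0 \<le> e2" using U.integral_unit[OF units(2)] by (simp add: e2)
  define \<delta> where "\<delta> = real R * measure_pmf.prob (poisson_pmf (\<theta> * real l)) {M<..}"
  have \<delta>: "0 \<le> \<delta>" by (simp add: \<delta>_def)
  define bad where "bad = (\<Union>j<R. {N. (\<Sum>x\<in>cell (a - n') l j. N x) < M})"
  have good: "h2 N \<le> e2 + \<delta>" if "N \<notin> bad" for N
  proof -
    have dense: "M \<le> (\<Sum>x\<in>cell (a - n') l j. N x)" if "j < R" for j
      using \<open>N \<notin> bad\<close> that by (auto simp: bad_def not_less)
    \<comment> \<open>The uniforms are moved outermost, since the domination is applied separately
      for each \<open>U\<close>.\<close>
    have "h2 N = (\<integral>U. \<integral>S. ?g2 N S U \<partial>steps_measure q \<partial>unifs_measure)"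
      unfolding h2_def by (rule integral_base_space(2)[OF q \<rho>' m2[OF \<rho>'] u2])
    also have "\<dots> \<le> (\<integral>U. (\<integral>N. \<integral>S. ?g2 N S U \<partial>steps_measure q \<partial>counts_measure \<rho>) + \<delta> \<partial>unifs_measure)"
    proof (intro integral_mono)
      show "integrable unifs_measure (\<lambda>U. \<integral>S. ?g2 N S U \<partial>steps_measure q)"
        by (rule U.integrable_unit[OF integral_base_space(6)[OF q \<rho>(1) m2[OF \<rho>(1)] u2] units(1)])
      show "integrable unifs_measure (\<lambda>U. (\<integral>N. \<integral>S. ?g2 N S U \<partial>steps_measure q \<partial>counts_measure \<rho>) + \<delta>)"
        by (intro Bochner_Integration.integrable_add U.integrable_const
            U.integrable_unit[OF integral_base_space(7)[OF q \<rho>(1) m2[OF \<rho>(1)] u2] units(2)])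
      show "(\<integral>S. ?g2 N S U \<partial>steps_measure q) \<le>
          (\<integral>N. \<integral>S. ?g2 N S U \<partial>steps_measure q \<partial>counts_measure \<rho>) + \<delta>" for U
        unfolding A2_def \<delta>_def by (rule quenched_le_annealed[OF q n f2(3,2,4) l R \<rho> \<theta> dense])
    qed
    also have "\<dots> = e2 + \<delta>"
      unfolding e2 using units(2) integral_base_space(7)[OF q \<rho>(1) m2[OF \<rho>(1)] u2]
      by (subst Bochner_Integration.integral_add) (auto intro!: U.integrable_unit simp: U.prob_space)
    finally show ?thesis .
  qed
  have bad_sets: "bad \<in> sets ?PN"
    unfolding bad_def by (intro sets.finite_UN sets_sum_less) auto
  have bad_le: "measure ?PN bad \<le> real R * exp (t * real M - \<rho>' * real l * (1 - exp (- t)))"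
  proof -
    have "measure ?PN bad \<le> (\<Sum>j<R. measure ?PN {N. (\<Sum>x\<in>cell (a - n') l j. N x) < M})"
      unfolding bad_def by (intro N.finite_measure_subadditive_finite) (auto intro!: sets_sum_less)
    also have "\<dots> \<le> (\<Sum>j<R. exp (t * real M - \<rho>' * real l * (1 - exp (- t))))"
      using poisson_sum_lower_tail[OF finite_cell \<rho>' t] by (intro sum_mono) (metis card_cell)
    finally show ?thesis by simp
  qed
  have "Exp q \<rho>' (\<lambda>z. f1 z * f2 z) \<le> (\<integral>N. h1 N * e2 + \<delta> + indicator bad N \<partial>?PN)"
    unfolding E12
  proof (rule integral_mono)
    fix N
    \<comment> \<open>On \<open>bad\<close> the trivial bound 1 is taken; elsewhere
      \<open>h1 N \<le> 1\<close> keeps the error at \<delta>.\<close>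
    show "h1 N * h2 N \<le> h1 N * e2 + \<delta> + indicator bad N"
    proof (cases "N \<in> bad")
      case True
      have "h1 N * h2 N \<le> 1" using h1[of N] h2[of N] by (auto intro: mult_le_one)
      moreover have "0 \<le> h1 N * e2" using h1[of N] e2_nonneg by simp
      ultimately show ?thesis using True \<delta> by simp
    next
      case False
      have "h1 N * h2 N \<le> h1 N * (e2 + \<delta>)" using good[OF False] h1[of N] by (intro mult_left_mono) auto
      moreover have "h1 N * \<delta> \<le> 1 * \<delta>" using h1[of N] \<delta> by (intro mult_right_mono) auto
      ultimately show ?thesis using False by (simp add: distrib_left)
    qed
  next
    have "h1 N * h2 N \<in> {0..1}" for N using h1[of N] h2[of N] by (auto intro: mult_le_one)
    then show "integrable ?PN (\<lambda>N. h1 N * h2 N)"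
      using h1_meas h2_meas by (intro N.integrable_unit) auto
    have "integrable ?PN (indicator bad :: _ \<Rightarrow> real)"
      using bad_sets by (intro N.integrable_unit) (auto simp: indicator_def)
    then show "integrable ?PN (\<lambda>N. h1 N * e2 + \<delta> + indicator bad N)"
      by (intro Bochner_Integration.integrable_add integrable_mult_left N.integrable_const N.integrable_unit[OF h1_meas h1])
  qed
  also have "\<dots> = (\<integral>N. h1 N \<partial>?PN) * e2 + \<delta> + measure ?PN bad"
  proof -
    have "integrable ?PN h1" "integrable ?PN (indicator bad :: _ \<Rightarrow> real)"
      using h1_meas h1 bad_sets by (auto intro!: N.integrable_unit simp: indicator_def)
    then show ?thesis using bad_sets by (simp add: N.prob_space sets.Int_space_eq2)
  qed
  finally show ?thesis using bad_le by (simp add: E1 e2_def \<delta>_def)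
qed

section \<open>Numerical bounds for the two tail exponents\<close>

lemma exp_le_quadratic: 
  fixes t :: real
  assumes "0 \<le> t" "t \<le> 1"
  shows "exp t \<le> 1 + t + t\<^sup>2" "t - t\<^sup>2 / 2 \<le> 1 - exp (- t)"
proof -
  show "exp t \<le> 1 + t + t\<^sup>2" using exp_bound[OF assms] .
  \<comment> \<open>Multiplying by the Taylor polynomial of \<open>exp (- t)\<close> turns an upper
    bound for \<open>exp (- t)\<close> into the known lower bound for \<open>exp t\<close>.\<close>
  have "(1 - t + t\<^sup>2 / 2) * exp t \<ge> (1 - t + t\<^sup>2 / 2) * (1 + t + t\<^sup>2 / 2)"
    using assms exp_lower_Taylor_quadratic[OF assms(1)] by (intro mult_left_mono) auto
  moreover have "(1 - t + t\<^sup>2 / 2) * (1 + t + t\<^sup>2 / 2) = 1 + t ^ 4 / 4"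
    by (simp add: field_simps power2_eq_square power4_eq_xxxx)
  ultimately have "1 \<le> (1 - t + t\<^sup>2 / 2) * exp t"
    using zero_le_power[OF assms(1), of 4] by linarith
  then have "exp (- t) \<le> 1 - t + t\<^sup>2 / 2"
    by (simp add: exp_minus field_simps)
  then show "t - t\<^sup>2 / 2 \<le> 1 - exp (- t)" by simp
qed

text \<open>Mean factor 1 + \<epsilon>/4 against threshold 1 + \<epsilon>/2. With Chernoff parameter
  \<epsilon>/10 and \<epsilon>^3 \<le> \<epsilon>^2 the coefficient is -1/40 + 1/100 + 1/400 =
  -1/80.\<close>

lemma upper_tail_exponent:
  fixes \<epsilon> L m :: real
  assumes "0 < \<epsilon>" "\<epsilon> \<le> 1" "0 \<le> L" "(1 + \<epsilon> / 2) * L \<le> m"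
  shows "(1 + \<epsilon> / 4) * L * (exp (\<epsilon> / 10) - 1) - \<epsilon> / 10 * m \<le> - (L * \<epsilon>\<^sup>2 / 80)"
proof -
  have "(1 + \<epsilon> / 4) * (exp (\<epsilon> / 10) - 1) \<le> (1 + \<epsilon> / 4) * (\<epsilon> / 10 + (\<epsilon> / 10)\<^sup>2)"
    using exp_le_quadratic(1)[of "\<epsilon> / 10"] assms by (intro mult_left_mono) auto
  moreover have "\<epsilon> ^ 3 \<le> \<epsilon>\<^sup>2"
    using assms by (intro power_decreasing) auto
  ultimately have "(1 + \<epsilon> / 4) * (exp (\<epsilon> / 10) - 1) - \<epsilon> / 10 * (1 + \<epsilon> / 2) \<le> - (\<epsilon>\<^sup>2 / 80)"
    by (simp add: field_simps power2_eq_square power3_eq_cube)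
  from mult_left_mono[OF this assms(3)] 
  have "(1 + \<epsilon> / 4) * L * (exp (\<epsilon> / 10) - 1) - \<epsilon> / 10 * ((1 + \<epsilon> / 2) * L) \<le> - (L * \<epsilon>\<^sup>2 / 80)"
    by (simp add: field_simps power2_eq_square)
  moreover have "\<epsilon> / 10 * ((1 + \<epsilon> / 2) * L) \<le> \<epsilon> / 10 * m"
    using assms by (intro mult_left_mono) auto
  ultimately show ?thesis by linarith
qed

text \<open>Mean factor 1 + \<epsilon> against threshold 1 + \<epsilon>/2. The parameter
  \<epsilon>/4 would give 1/8 - 7/32 + 1/32 = -1/16; the weaker -1/80 matches the upper
  tail.\<close>

lemma lower_tail_exponent:
  fixes \<epsilon> L m :: real
  assumes "0 < \<epsilon>" "\<epsilon> \<le> 1" "0 \<le> L" "m \<le> (1 + \<epsilon> / 2) * L"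
  shows "\<epsilon> / 4 * m - (1 + \<epsilon>) * L * (1 - exp (- (\<epsilon> / 4))) \<le> - (L * \<epsilon>\<^sup>2 / 80)"
proof -
  have lower: "(1 + \<epsilon>) * (\<epsilon> / 4 - (\<epsilon> / 4)\<^sup>2 / 2) \<le> (1 + \<epsilon>) * (1 - exp (- (\<epsilon> / 4)))"
    using exp_le_quadratic(2)[of "\<epsilon> / 4"] assms by (intro mult_left_mono) auto
  have cube: "\<epsilon> ^ 3 \<le> \<epsilon>\<^sup>2"
    using assms by (intro power_decreasing) auto
  have "\<epsilon> / 4 * (1 + \<epsilon> / 2) - (1 + \<epsilon>) * (1 - exp (- (\<epsilon> / 4))) \<le> - (\<epsilon>\<^sup>2 / 80)"
  proof -
    have "(1 + \<epsilon>) * (\<epsilon> / 4 - (\<epsilon> / 4)\<^sup>2 / 2) = \<epsilon> / 4 + 7 / 32 * \<epsilon>\<^sup>2 - \<epsilon> ^ 3 / 32"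
      "\<epsilon> / 4 * (1 + \<epsilon> / 2) = \<epsilon> / 4 + \<epsilon>\<^sup>2 / 8"
      by (simp_all add: field_simps power2_eq_square power3_eq_cube)
    with lower cube zero_le_power2[of \<epsilon>] show ?thesis by linarith
  qed
  from mult_left_mono[OF this assms(3)] 
  have "\<epsilon> / 4 * ((1 + \<epsilon> / 2) * L) - (1 + \<epsilon>) * L * (1 - exp (- (\<epsilon> / 4))) \<le> - (L * \<epsilon>\<^sup>2 / 80)"
    by (simp add: field_simps power2_eq_square)
  moreover have "\<epsilon> / 4 * m \<le> \<epsilon> / 4 * ((1 + \<epsilon> / 2) * L)"
    using assms by (intro mult_left_mono) auto
  ultimately show ?thesis by linarith
qed

theorem theoremC1:
  fixes q p_circ p_bullet :: real
  assumes "0 < q" "q < 1" "0 \<le> p_circ" "p_circ \<le> 1" "0 \<le> p_bullet" "p_bullet \<le> 1"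
  shows "\<exists>c0 c :: real. c0 > 0 \<and> c > 0 \<and>
    (\<forall>a b n n' :: int. \<forall>f1 f2 :: config \<times> unifs \<Rightarrow> real. \<forall>\<rho> :: real.
       a \<le> b \<longrightarrow> n \<le> n' \<longrightarrow> real_of_int n \<ge> c0 \<longrightarrow>
       random_var q f1 \<longrightarrow> random_var q f2 \<longrightarrow>
       (\<forall>z\<in>Omega. f1 z \<in> {0..1}) \<longrightarrow> (\<forall>z\<in>Omega. f2 z \<in> {0..1}) \<longrightarrow>
       nonincreasing f1 \<longrightarrow> nonincreasing f2 \<longrightarrow>
       has_support f1 Dneg \<longrightarrow> has_support f2 (box a b n n') \<longrightarrow>
       \<rho> \<ge> 1 \<longrightarrow>
       Exp q (\<rho> * (1 + real_of_int n powr (-1/16))) (\<lambda>z. f1 z * f2 z)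
         \<le> Exp q (\<rho> * (1 + real_of_int n powr (-1/16))) f1 * Exp q \<rho> f2
           + c * (perimeter a b n n' + real_of_int n)
               * exp (- c * \<rho> * real_of_int n powr (1/8)))"
proof -
  define \<sigma> where "\<sigma> = 1 / q + 2 / (1 - q)"
  \<comment> \<open>A lower bound for n^(1/16): 800 lets half of the final exponent absorb the
    numerical prefactors, and \<open>8 * sqrt \<sigma>\<close> keeps the kernel loss below
    \<epsilon>/8.\<close>
  define K where "K = 800 + 8 * sqrt \<sigma>"
  have \<sigma>: "0 < \<sigma>" using assms unfolding \<sigma>_def by (intro add_pos_pos) auto
  then have K: "800 \<le> K" "8 * sqrt \<sigma> \<le> K" by (simp_all add: K_def)
  have main: "Exp q (\<rho> * (1 + real_of_int n powr (-1/16))) (\<lambda>z. f1 z * f2 z)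
         \<le> Exp q (\<rho> * (1 + real_of_int n powr (-1/16))) f1 * Exp q \<rho> f2
           + 1 / 320 * (perimeter a b n n' + real_of_int n) * exp (- (1 / 320) * \<rho> * real_of_int n powr (1/8))"
    if ab: "a \<le> b" and nn': "n \<le> n'" and n: "K ^ 16 \<le> real_of_int n"
      and f: "random_var q f1" "random_var q f2" "\<forall>z\<in>Omega. f1 z \<in> {0..1}" "\<forall>z\<in>Omega. f2 z \<in> {0..1}"
        "nonincreasing f2" "has_support f1 Dneg" "has_support f2 (box a b n n')" and \<rho>: "1 \<le> \<rho>"
    for a b n n' :: int and f1 f2 :: "config \<times> unifs \<Rightarrow> real" and \<rho> :: real
  proof -
    \<comment> \<open>All scales become integer powers of \<open>y\<close>: n = y^16, the cell
      length is about y^4, \<epsilon> = 1/y, and n^(1/8) = y^2.\<close>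
    define y where "y = real_of_int n powr (1/16)"
    have n0: "0 < real_of_int n" using K(1) by (intro less_le_trans[OF _ n]) simp
    have n_pos: "0 < n" using n0 by simp
    have y16: "real_of_int n = y ^ 16"
      using n0 by (simp add: y_def powr_realpow[symmetric] powr_powr)
    have "K \<le> y"
    proof (rule power_le_imp_le_base)
      show "K ^ Suc 15 \<le> y ^ Suc 15" using n y16 by simp
    qed (simp add: y_def)
    then have y: "800 \<le> y" "8 * sqrt \<sigma> \<le> y" using K by auto
    define \<epsilon> where "\<epsilon> = 1 / y"
    have \<epsilon>: "0 < \<epsilon>" "\<epsilon> \<le> 1" using y by (simp_all add: \<epsilon>_def)
    have n_eps: "real_of_int n powr (-1/16) = \<epsilon>"
      by (simp add: \<epsilon>_def y_def powr_minus_divide)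
    have n8: "real_of_int n powr (1/8) = y\<^sup>2"
      using n0 by (simp add: y_def powr_realpow[symmetric] powr_powr)
    define l where "l = nat \<lfloor>y ^ 4\<rfloor>"
    have y4: "2 \<le> y ^ 4" using power_mono[of 2 y 4] y by simp
    have l_le: "real l \<le> y ^ 4" using y4 by (simp add: l_def)
    have l_ge: "y ^ 4 / 2 \<le> real l" using y4 unfolding l_def by linarith
    have l_pos: "0 < l" using l_ge y4 by (cases l) auto
    \<comment> \<open>As many cells as sites to be covered: wasteful, but it covers them for every
      \<open>l \<ge> 1\<close>, and \<open>R\<close> enters only through the prefactor.\<close>
    define R where "R = nat (b - a + 2 * n' + 1)"
    have R_int: "int R = b - a + 2 * n' + 1" using ab nn' n_pos by (simp add: R_def)
    have R: "b - a + 2 * n' < int (R * l)"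
    proof -
      have "int R * 1 \<le> int R * int l" using l_pos by (intro mult_left_mono) auto
      then show ?thesis using R_int by simp
    qed
    have R_le: "real R \<le> 3 * (perimeter a b n n' + real_of_int n)"
    proof -
      have "int R \<le> 3 * (2 * ((b - a) + (n' - n)) + n)" using R_int ab nn' n_pos by simp
      then have "real_of_int (int R) \<le> real_of_int (3 * (2 * ((b - a) + (n' - n)) + n))"
        by (simp only: of_int_le_iff)
      then show ?thesis by (simp add: perimeter_def)
    qed
    define \<theta> where "\<theta> = \<rho> * (1 + \<epsilon> / 4)"
    define L where "L = \<rho> * real l"
    define M where "M = nat \<lfloor>(1 + \<epsilon> / 2) * L\<rfloor>"
    have L: "0 \<le> L" using \<rho> by (simp add: L_def)
    have M_bounds: "real M \<le> (1 + \<epsilon> / 2) * L" "(1 + \<epsilon> / 2) * L \<le> real (Suc M)"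
    proof -
      have "0 \<le> (1 + \<epsilon> / 2) * L" using L \<epsilon> by simp
      then show "real M \<le> (1 + \<epsilon> / 2) * L" "(1 + \<epsilon> / 2) * L \<le> real (Suc M)"
        unfolding M_def by linarith+
    qed
    have \<theta>_pos: "0 < \<theta>" using \<rho> \<epsilon> by (simp add: \<theta>_def)
    \<comment> \<open>With \<open>l \<le> y ^ 4\<close> and \<open>sqrt \<sigma> \<le> y / 8\<close>
      the loss is at most 1/(8 y^3) \<le> \<epsilon>/8, and (1 + \<epsilon>/4)(1 - \<epsilon>/8) is
      still at least 1.\<close>
    have \<rho>_le: "\<rho> \<le> \<theta> * (1 - real l * sqrt ((1 / q + 2 / (1 - q)) / real (Suc (nat n))))"
    proof -
      have "sqrt (\<sigma> / real (Suc (nat n))) \<le> sqrt (\<sigma> / y ^ 16)"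
        using \<sigma> n_pos y16 n0 by (intro real_sqrt_le_mono divide_left_mono) auto
      also have "\<dots> = sqrt \<sigma> / y ^ 8"
        using y real_sqrt_pow2[of "y ^ 8"] by (simp add: real_sqrt_divide real_sqrt_unique flip: power_mult)
      finally have "real l * sqrt (\<sigma> / real (Suc (nat n))) \<le> y ^ 4 * (sqrt \<sigma> / y ^ 8)"
        using l_le y \<sigma> by (intro mult_mono) auto
      also have "\<dots> \<le> y ^ 4 * ((y / 8) / y ^ 8)"
        using y by (intro mult_left_mono divide_right_mono) auto
      also have "\<dots> = 1 / (8 * y ^ 3)"
        using y by (simp add: field_simps power_numeral_reduce)
      also have "\<dots> \<le> \<epsilon> / 8"
        using y by (simp add: \<epsilon>_def field_simps power_numeral_reduce) (smt (verit) mult_le_cancel_left1 mult_less_cancel_left2)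
      finally have *: "1 - \<epsilon> / 8 \<le> 1 - real l * sqrt (\<sigma> / real (Suc (nat n)))" by simp
      have "\<epsilon> * \<epsilon> \<le> \<epsilon> * 1" using \<epsilon> by (intro mult_left_mono) auto
      then have "1 \<le> (1 + \<epsilon> / 4) * (1 - \<epsilon> / 8)" using \<epsilon> by (simp add: field_simps)
      also have "\<dots> \<le> (1 + \<epsilon> / 4) * (1 - real l * sqrt (\<sigma> / real (Suc (nat n))))"
        using * \<epsilon> by (intro mult_left_mono) auto
      finally show ?thesis
        using \<rho> by (simp add: \<theta>_def \<sigma>_def mult.assoc)
    qed
    define X where "X = \<rho> * y\<^sup>2"
    \<comment> \<open>Rounding the cell length down costs at most a factor 2, which turns 80 into
      160.\<close>
    have LX: "X / 160 \<le> L * \<epsilon>\<^sup>2 / 80"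
    proof -
      have "X / 2 = \<rho> * (y ^ 4 / 2) * \<epsilon>\<^sup>2"
        using y by (simp add: X_def \<epsilon>_def field_simps power_numeral_reduce)
      also have "\<dots> \<le> L * \<epsilon>\<^sup>2"
        unfolding L_def using l_ge \<rho> by (intro mult_right_mono mult_left_mono) auto
      finally show ?thesis by simp
    qed
    have upper: "measure_pmf.prob (poisson_pmf (\<theta> * real l)) {M<..} \<le> exp (- (X / 160))"
    proof -
      have "measure_pmf.prob (poisson_pmf (\<theta> * real l)) {M<..} \<le>
          exp (\<theta> * real l * (exp (\<epsilon> / 10) - 1) - \<epsilon> / 10 * real (Suc M))"
        using \<theta>_pos l_pos \<epsilon> by (intro poisson_upper_tail) auto
      also have "\<dots> \<le> exp (- (X / 160))"
        using upper_tail_exponent[OF \<epsilon> L M_bounds(2)] LX by (simp add: \<theta>_def L_def mult_ac)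
      finally show ?thesis .
    qed
    have lower: "exp (\<epsilon> / 4 * real M - \<rho> * (1 + \<epsilon>) * real l * (1 - exp (- (\<epsilon> / 4)))) \<le> exp (- (X / 160))"
      using lower_tail_exponent[OF \<epsilon> L M_bounds(1)] LX by (simp add: L_def mult_ac)
    \<comment> \<open>Two tails and the factor 3 from \<open>R_le\<close> make 6, and the same 1/320
      must serve as prefactor: 6 * 320 = 1920. Half of the exponent pays for it, since X \<ge> 800^2
      gives X/320 \<ge> 2000.\<close>
    have small: "6 * exp (- (X / 160)) \<le> 1 / 320 * exp (- (X / 320))"
    proof -
      have "1 * 800\<^sup>2 \<le> \<rho> * y\<^sup>2" using \<rho> y by (intro mult_mono power_mono) auto
      then have "1920 \<le> 1 + X / 320" by (simp add: X_def)
      also have "\<dots> \<le> exp (X / 320)" by (rule exp_ge_add_one_self)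
      finally have "1920 * exp (- (X / 160)) \<le> exp (X / 320) * exp (- (X / 160))"
        by (intro mult_right_mono) auto
      also have "\<dots> = exp (- (X / 320))" by (simp add: exp_add[symmetric])
      finally show ?thesis by simp
    qed
    have "Exp q (\<rho> * (1 + \<epsilon>)) (\<lambda>z. f1 z * f2 z) \<le> Exp q (\<rho> * (1 + \<epsilon>)) f1 * Exp q \<rho> f2 +
        real R * measure_pmf.prob (poisson_pmf (\<theta> * real l)) {M<..} +
        real R * exp (\<epsilon> / 4 * real M - \<rho> * (1 + \<epsilon>) * real l * (1 - exp (- (\<epsilon> / 4))))"
      using assms(1,2) n_pos nn' f l_pos R \<rho> \<rho>_le \<theta>_pos \<epsilon> by (intro decoupling) auto
    also have "\<dots> \<le> Exp q (\<rho> * (1 + \<epsilon>)) f1 * Exp q \<rho> f2 + real R * exp (- (X / 160)) + real R * exp (- (X / 160))"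
      using upper lower by (intro add_mono mult_left_mono order.refl) auto
    also have "\<dots> \<le> Exp q (\<rho> * (1 + \<epsilon>)) f1 * Exp q \<rho> f2 +
        (perimeter a b n n' + real_of_int n) * (6 * exp (- (X / 160)))"
      using mult_right_mono[OF R_le, of "2 * exp (- (X / 160))"] by simp
    also have "\<dots> \<le> Exp q (\<rho> * (1 + \<epsilon>)) f1 * Exp q \<rho> f2 +
        (perimeter a b n n' + real_of_int n) * (1 / 320 * exp (- (X / 320)))"
      using small ab nn' n0 by (intro add_left_mono mult_left_mono) (auto simp: perimeter_def)
    finally show ?thesis unfolding n_eps n8 by (simp add: X_def mult_ac)
  qed
  show ?thesis
    by (rule exI[of _ "K ^ 16"], rule exI[of _ "1 / 320"]) (use K(1) main in auto)
qed

end
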